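(* Let $q$ be a prime power and $n\ge2$ with $\gcd(q,n)=1$, and use the notation of the context. Let $C\subset\mathbb{F}_qD_n$ be a dihedral code and write $$\mathcal{P}(C)=\bigoplus_{j=1}^{r+s}B_j,\qquad B_j=\begin{cases}A_j,&j\in J_1\\ I_j(0,1),&j\in J_2\\ I_j(1,0),&j\in J_3\\ I_j(-x_j,1),&j\in J_4\\ 0,&j\notin J_1\cup J_2\cup J_3\cup J_4,\end{cases}$$ where $0\ne x_j\in F_j$ and $J_1,J_2,J_3\subset\{1,\dots,r+s\}$, $J_4\subset\{\zeta(n)+1,\dots,r+s\}$ are pairwise disjoint, with $1\notin J_2$ if $q$ is even. Then $$\mathcal{P}(C_{int})=\bigoplus_{j=1}^{r+s}B_j^{int},\qquad B_j^{int}=\begin{cases}A_j,&j\in K_1\\ I_j(0,1),&j\in K_2\\ I_j(1,0),&j\in K_3\\ 0,&j\notin K_1\cup K_2\cup K_3,\end{cases}$$ where $$K_1=J_1,\qquad K_2=\{j\in J_2\mid r+1\le j\le r+s\},\qquad K_3=\{j\in J_3\mid r+1\le j\le r+s\}.$$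
   Context: $D_n=\langle a,b\mid a^n=1,\ b^2=1,\ bab=a^{-1}\rangle$ is the dihedral group of order $2n$, $\mathbb{F}_qD_n$ its group algebra; every element is uniquely $P(a)+bQ(a)$ with $P,Q\in\mathbb{F}_q[x]$ of degree less than $n$. A dihedral code is a left ideal of $\mathbb{F}_qD_n$. $\mathbb{F}_q\langle a\rangle\subset\mathbb{F}_qD_n$ is the group algebra of the cyclic subgroup generated by $a$. For a dihedral code $C$, the interior induced code is $C_{int}=(\mathbb{F}_qD_n)(C\cap\mathbb{F}_q\langle a\rangle)$, the left ideal generated by $C\cap\mathbb{F}_q\langle a\rangle$. For $g\in\mathbb{F}_q[x]$ with $g(0)\neq0$ put $g^*(x)=x^{\deg g}g(x^{-1})$. Factor $x^n-1$ over $\mathbb{F}_q$ into (pairwise distinct) monic irreducible factors as $x^n-1=(f_1f_2\cdots f_r)(f_{r+1}f_{r+1}^*\cdots f_{r+s}f_{r+s}^* )$, where $f_1=x-1$, $f_2=x+1$ if $n$ is even, $f_j^*=f_j$ for $1<j\le r$, and for $j>r$ the polynomials $f_j$ and $f_j^*$ have different roots (here the factor $f_j^*$, $j>r$, is normalized by a scalar to be monic). Let $\alpha_j$ be a root of $f_j$. Let $\zeta(n)=1$ if $n$ is odd, $\zeta(n)=2$ if $n$ is even. $\langle h\mid h^2\rangle$ is the cyclic group of order 2 generated by $h$. Put $F_j=\mathbb{F}_q$ for $1\le j\le\zeta(n)$, $F_j=\mathbb{F}_q[\alpha_j+\alpha_j^{-1}]$ for $\zeta(n)+1\le j\le r$,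 $F_j=\mathbb{F}_q[\alpha_j]$ for $r+1\le j\le r+s$. Put $A_j=\mathbb{F}_q\langle h\mid h^2\rangle$ for $1\le j\le\zeta(n)$ and $A_j=\mathrm{M}_2(F_j)$ for $\zeta(n)+1\le j\le r+s$. Define for $u=P(a)+bQ(a)$: $\gamma_1(u)=P(1)+Q(1)h$; $\gamma_2(u)=P(-1)+Q(-1)h$ (for $n$ even); for $j\ge\zeta(n)+1$, $\tau_j(u)=\begin{pmatrix}P(\alpha_j)&Q(\alpha_j^{-1})\\ Q(\alpha_j)&P(\alpha_j^{-1})\end{pmatrix}$; for $\zeta(n)+1\le j\le r$, $\sigma_j(X)=Z_j^{-1}XZ_j$ with $Z_j=\begin{pmatrix}1&-\alpha_j\\ 1&-\alpha_j^{-1}\end{pmatrix}$. Put $\mathcal{P}_j=\gamma_j$ for $j\le\zeta(n)$, $\mathcal{P}_j=\sigma_j\tau_j$ for $\zeta(n)+1\le j\le r$, $\mathcal{P}_j=\tau_j$ for $r+1\le j\le r+s$. It is known that $\mathcal{P}=\bigoplus_{j=1}^{r+s}\mathcal{P}_j:\mathbb{F}_qD_n\to\bigoplus_{j=1}^{r+s}A_j$ is an algebra isomorphism. For $x,y\in F_j$ put $I_j(x,y)=\mathbb{F}_q\langle h\mid h^2\rangle\left[(x+y)+(x-y)h\right]$ for $1\le j\le\zeta(n)$, and $I_j(x,y)=\left\{\begin{pmatrix}ky & -kx \\ ty & -tx\end{pmatrix}\mid k,t\in F_j\right\}$ for $\zeta(n)+1\le j\le r+s$. Every dihedral code has an image under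 $\mathcal P$ of the form written in the claim. *)

theory Defs
  imports
    "HOL-Analysis.Analysis"
    "HOL-Algebra.Elementary_Groups"
    "HOL-Algebra.Ideal"
    "HOL-Algebra.Algebraic_Closure_Type"
begin

section \<open>Group algebras and left ideals\<close>

text \<open>
  The group algebra of a finite group \<open>G\<close> with coefficients in a subring \<open>K\<close> of a field type:
  the function \<open>u\<close> stands for the formal sum of all \<open>u g \<cdot> g\<close>, multiplied by convolution.
\<close>

definition group_algebra :: "'k::field set \<Rightarrow> ('g, 'm) monoid_scheme \<Rightarrow> ('g \<Rightarrow> 'k) ring" where
  "group_algebra K G =
    \<lparr>carrier = carrier G \<rightarrow>\<^sub>E K,
     monoid.mult = (\<lambda>u v. \<lambda>g\<in>carrier G. \<Sum>x\<in>carrier G. u x * v (inv\<^bsub>G\<^esub> x \<otimes>\<^bsub>G\<^esub> g)),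
     one = (\<lambda>g\<in>carrier G. if g = \<one>\<^bsub>G\<^esub> then 1 else 0),
     ring.zero = (\<lambda>g\<in>carrier G. 0),
     add = (\<lambda>u v. \<lambda>g\<in>carrier G. u g + v g)\<rparr>"

definition left_ideal :: "'b set \<Rightarrow> ('b, 'm) ring_scheme \<Rightarrow> bool" where
  "left_ideal I R \<longleftrightarrow>
    additive_subgroup I R \<and> (\<forall>r\<in>carrier R. \<forall>x\<in>I. r \<otimes>\<^bsub>R\<^esub> x \<in> I)"

definition left_ideal_generated :: "('b, 'm) ring_scheme \<Rightarrow> 'b set \<Rightarrow> 'b set" where
  "left_ideal_generated R S = \<Inter>{I. left_ideal I R \<and> S \<subseteq> I}"

lemma ring_group_algebra:
  fixes K :: "'k::field set" and G (structure)
  assumes G: "group G" and fin: "finite (carrier G)"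
    and K: "0 \<in> K" "1 \<in> K" "\<And>x y. x \<in> K \<Longrightarrow> y \<in> K \<Longrightarrow> x + y \<in> K"
      "\<And>x y. x \<in> K \<Longrightarrow> y \<in> K \<Longrightarrow> x * y \<in> K" "\<And>x. x \<in> K \<Longrightarrow> - x \<in> K"
  shows "ring (group_algebra K G)"
proof -
  interpret group G by fact
  have sumK: "(\<Sum>x\<in>A. f x) \<in> K" if "\<And>x. x \<in> A \<Longrightarrow> f x \<in> K" for A and f :: "_ \<Rightarrow> 'k"
    using that by (induction A rule: infinite_finite_induct) (auto simp: K)
  have shift: "(\<Sum>y\<in>carrier G. f (x \<otimes> y)) = (\<Sum>y\<in>carrier G. f y)"
    if "x \<in> carrier G" for x and f :: "_ \<Rightarrow> 'k"
    by (rule sum.reindex_bij_witness[where i = "\<lambda>y. inv x \<otimes> y" and j = "\<lambda>y. x \<otimes> y"])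
      (use that in \<open>auto simp: m_assoc[symmetric]\<close>)
  show ?thesis
  proof (rule ringI)
    show "abelian_group (group_algebra K G)"
    proof (rule abelian_groupI)
      fix u assume u: "u \<in> carrier (group_algebra K G)"
      show "\<exists>v\<in>carrier (group_algebra K G). v \<oplus>\<^bsub>group_algebra K G\<^esub> u = \<zero>\<^bsub>group_algebra K G\<^esub>"
        by (rule bexI[of _ "\<lambda>g\<in>carrier G. - u g"])
          (use u in \<open>auto simp: group_algebra_def intro!: restrict_ext K(5) PiE_mem[of u "carrier G"]\<close>)
    next
      fix u v assume "u \<in> carrier (group_algebra K G)" "v \<in> carrier (group_algebra K G)"
      then show "u \<oplus>\<^bsub>group_algebra K G\<^esub> v \<in> carrier (group_algebra K G)"
        by (simp add: group_algebra_def PiE_iff K(3))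
    next
      show "\<zero>\<^bsub>group_algebra K G\<^esub> \<in> carrier (group_algebra K G)"
        by (simp add: group_algebra_def K(1))
    next
      fix u v w
      assume "u \<in> carrier (group_algebra K G)" "v \<in> carrier (group_algebra K G)"
        "w \<in> carrier (group_algebra K G)"
      show "u \<oplus>\<^bsub>group_algebra K G\<^esub> v \<oplus>\<^bsub>group_algebra K G\<^esub> w
          = u \<oplus>\<^bsub>group_algebra K G\<^esub> (v \<oplus>\<^bsub>group_algebra K G\<^esub> w)"
        by (auto simp: group_algebra_def add.assoc intro!: restrict_ext)
    next
      fix u v
      show "u \<oplus>\<^bsub>group_algebra K G\<^esub> v = v \<oplus>\<^bsub>group_algebra K G\<^esub> u"
        by (auto simp: group_algebra_def add.commute intro!: restrict_ext)
    next
      fix u assume "u \<in> carrier (group_algebra K G)"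
      then show "\<zero>\<^bsub>group_algebra K G\<^esub> \<oplus>\<^bsub>group_algebra K G\<^esub> u = u"
        by (auto simp: group_algebra_def PiE_def extensional_def fun_eq_iff)
    qed
    show "monoid (group_algebra K G)"
    proof (rule monoidI)
      fix u v assume uv: "u \<in> carrier (group_algebra K G)" "v \<in> carrier (group_algebra K G)"
      show "u \<otimes>\<^bsub>group_algebra K G\<^esub> v \<in> carrier (group_algebra K G)"
        using uv by (simp add: group_algebra_def PiE_iff sumK K(4))
      fix w assume w: "w \<in> carrier (group_algebra K G)"
      show "u \<otimes>\<^bsub>group_algebra K G\<^esub> v \<otimes>\<^bsub>group_algebra K G\<^esub> w
          = u \<otimes>\<^bsub>group_algebra K G\<^esub> (v \<otimes>\<^bsub>group_algebra K G\<^esub> w)"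
      proof -
        have "(\<Sum>x\<in>carrier G. (\<Sum>y\<in>carrier G. u y * v (inv y \<otimes> x)) * w (inv x \<otimes> g))
            = (\<Sum>x\<in>carrier G. u x * (\<Sum>y\<in>carrier G. v y * w (inv y \<otimes> (inv x \<otimes> g))))"
          if g: "g \<in> carrier G" for g
        proof -
          have "(\<Sum>x\<in>carrier G. (\<Sum>y\<in>carrier G. u y * v (inv y \<otimes> x)) * w (inv x \<otimes> g))
              = (\<Sum>y\<in>carrier G. u y * (\<Sum>x\<in>carrier G. v (inv y \<otimes> x) * w (inv x \<otimes> g)))"
            unfolding sum_distrib_left sum_distrib_right
            by (subst sum.swap) (simp add: mult_ac)
          also have "\<dots> = (\<Sum>y\<in>carrier G. u y * (\<Sum>x\<in>carrier G. v x * w (inv x \<otimes> (inv y \<otimes> g))))"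
          proof -
            have "(\<Sum>x\<in>carrier G. v (inv y \<otimes> x) * w (inv x \<otimes> g))
                = (\<Sum>x\<in>carrier G. v x * w (inv x \<otimes> (inv y \<otimes> g)))"
              if y: "y \<in> carrier G" for y
            proof -
              have "(\<Sum>x\<in>carrier G. v (inv y \<otimes> x) * w (inv x \<otimes> g))
                  = (\<Sum>x\<in>carrier G. v (inv y \<otimes> (y \<otimes> x)) * w (inv (y \<otimes> x) \<otimes> g))"
                by (rule shift[OF y, symmetric])
              also have "\<dots> = (\<Sum>x\<in>carrier G. v x * w (inv x \<otimes> (inv y \<otimes> g)))"
                by (rule sum.cong) (use y g in \<open>simp_all add: m_assoc[symmetric] inv_mult_group\<close>)
              finally show ?thesis .
            qed
            then show ?thesis by simp
          qed
          finally show ?thesis .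
        qed
        then show ?thesis
          by (auto simp: group_algebra_def intro!: restrict_ext)
      qed
    next
      fix u assume u: "u \<in> carrier (group_algebra K G)"
      have ext: "u = restrict u (carrier G)"
        using u by (auto simp: group_algebra_def PiE_def extensional_restrict)
      have "(\<Sum>x\<in>carrier G. (if x = \<one> then 1 else 0) * u (inv x \<otimes> g)) = u g"
        if "g \<in> carrier G" for g
        using that fin by (simp add: if_distrib[of "\<lambda>z. z * _"] sum.delta cong: if_cong)
      then show "\<one>\<^bsub>group_algebra K G\<^esub> \<otimes>\<^bsub>group_algebra K G\<^esub> u = u"
        by (subst (2) ext) (auto simp: group_algebra_def intro!: restrict_ext)
      have "(\<Sum>x\<in>carrier G. u x * (if inv x \<otimes> g = \<one> then 1 else 0)) = u g"
        if g: "g \<in> carrier G" for g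
      proof -
        have "(\<Sum>x\<in>carrier G. u x * (if inv x \<otimes> g = \<one> then 1 else 0))
            = (\<Sum>x\<in>carrier G. if x = g then u x else 0)"
          by (rule sum.cong) (use g in \<open>auto simp: inv_solve_left' dest: inv_equality\<close>)
        then show ?thesis using g fin by simp
      qed
      then show "u \<otimes>\<^bsub>group_algebra K G\<^esub> \<one>\<^bsub>group_algebra K G\<^esub> = u"
        by (subst (2) ext) (auto simp: group_algebra_def intro!: restrict_ext)
    qed (auto simp: group_algebra_def K(1,2))
  qed (auto simp: group_algebra_def distrib_left distrib_right sum.distrib intro!: restrict_ext)
qed


section \<open>The dihedral group and its group algebra\<close>

text \<open>The pair \<open>(e, i)\<close> stands for \<open>b a\<^sup>i\<close> if \<open>e\<close> holds and for \<open>a\<^sup>i\<close> otherwise.\<close>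

definition dihedral_group :: "nat \<Rightarrow> (bool \<times> int) monoid" where
  "dihedral_group n =
    \<lparr>carrier = UNIV \<times> {0..<int n},
     monoid.mult = (\<lambda>(e, i) (e', i'). (e \<noteq> e', ((if e' then - i else i) + i') mod int n)),
     one = (False, 0)\<rparr>"

definition rotation :: "nat \<Rightarrow> bool \<times> int" where
  "rotation n = (False, 1 mod int n)"

definition reflection :: "bool \<times> int" where
  "reflection = (True, 0)"

lemma group_dihedral_group:
  assumes "n > 0"
  shows "group (dihedral_group n)"
proof (rule groupI)
  fix x assume "x \<in> carrier (dihedral_group n)"
  then obtain e i where x: "x = (e, i)" and i: "0 \<le> i" "i < int n"
    by (auto simp: dihedral_group_def)
  show "\<exists>y\<in>carrier (dihedral_group n). y \<otimes>\<^bsub>dihedral_group n\<^esub> x = \<one>\<^bsub>dihedral_group n\<^esub>"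
    by (rule bexI[of _ "(e, (if e then i else - i) mod int n)"])
      (use assms i in \<open>auto simp: dihedral_group_def x mod_simps\<close>)
qed (use assms in \<open>auto simp: dihedral_group_def mod_simps algebra_simps split: if_splits\<close>)

lemma rotation_pow:
  "n > 0 \<Longrightarrow> rotation n [^]\<^bsub>dihedral_group n\<^esub> (k::nat) = (False, int k mod int n)"
  by (induction k) (auto simp: nat_pow_def dihedral_group_def rotation_def mod_simps add_ac)

text \<open>The defining relations hold, \<open>a\<close> and \<open>b\<close> generate, and the order is \<open>2n\<close>.\<close>

lemma dihedral_group_presentation:
  fixes n :: nat
  assumes n: "n > 0"
  defines "D \<equiv> dihedral_group n" and "a \<equiv> rotation n" and "b \<equiv> reflection"
  shows "a [^]\<^bsub>D\<^esub> n = \<one>\<^bsub>D\<^esub>" "b [^]\<^bsub>D\<^esub> (2::nat) = \<one>\<^bsub>D\<^esub>"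
    "b \<otimes>\<^bsub>D\<^esub> a \<otimes>\<^bsub>D\<^esub> b = inv\<^bsub>D\<^esub> a" "generate D {a, b} = carrier D" "order D = 2 * n"
proof -
  interpret group D using group_dihedral_group n by (simp add: D_def)
  have ab: "a \<in> carrier D" "b \<in> carrier D"
    using n by (auto simp: D_def a_def b_def rotation_def reflection_def dihedral_group_def)
  show "a [^]\<^bsub>D\<^esub> n = \<one>\<^bsub>D\<^esub>"
    using n by (simp add: D_def a_def rotation_pow) (simp add: dihedral_group_def)
  show "b [^]\<^bsub>D\<^esub> (2::nat) = \<one>\<^bsub>D\<^esub>"
    using ab by (simp add: numeral_2_eq_2) (simp add: D_def b_def reflection_def dihedral_group_def)
  have "b \<otimes>\<^bsub>D\<^esub> a \<otimes>\<^bsub>D\<^esub> b \<otimes>\<^bsub>D\<^esub> a = \<one>\<^bsub>D\<^esub>"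
    by (simp add: D_def a_def b_def rotation_def reflection_def dihedral_group_def mod_simps)
  then show "b \<otimes>\<^bsub>D\<^esub> a \<otimes>\<^bsub>D\<^esub> b = inv\<^bsub>D\<^esub> a"
    using ab by (metis inv_equality m_closed)
  show "order D = 2 * n"
    by (simp add: order_def D_def dihedral_group_def card_cartesian_product)
  show "generate D {a, b} = carrier D"
  proof
    show "generate D {a, b} \<subseteq> carrier D" using ab by (intro generate_incl) auto
    show "carrier D \<subseteq> generate D {a, b}"
    proof
      fix x assume "x \<in> carrier D"
      then obtain e i where x: "x = (e, i)" and i: "0 \<le> i" "i < int n"
        by (auto simp: D_def dihedral_group_def)
      have rot: "a [^]\<^bsub>D\<^esub> k \<in> generate D {a, b}" for k :: nat
        by (induction k) (auto intro: generate.intros)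
      have "a [^]\<^bsub>D\<^esub> nat i = (False, i)"
        using rotation_pow[OF n, of "nat i"] i by (simp add: D_def a_def)
      then have rot_i: "(False, i) \<in> generate D {a, b}" using rot[of "nat i"] by simp
      have "b \<otimes>\<^bsub>D\<^esub> (False, i) = (True, i)"
        using i by (simp add: D_def b_def reflection_def dihedral_group_def)
      then have "(True, i) \<in> generate D {a, b}"
        using rot_i generate.eng[of b D "{a, b}" "(False, i)"] by (auto intro: generate.incl)
      with rot_i show "x \<in> generate D {a, b}" by (cases e) (auto simp: x)
    qed
  qed
qed

definition dihedral_algebra :: "nat \<Rightarrow> (bool \<times> int \<Rightarrow> 'a::field) ring" where
  "dihedral_algebra n = group_algebra UNIV (dihedral_group n)"

definition cyclic_subalgebra :: "nat \<Rightarrow> (bool \<times> int \<Rightarrow> 'a::field) set" where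
  "cyclic_subalgebra n =
    {u \<in> carrier (dihedral_algebra n).
      \<forall>g \<in> carrier (dihedral_group n) - generate (dihedral_group n) {rotation n}. u g = 0}"

definition interior_code :: "nat \<Rightarrow> (bool \<times> int \<Rightarrow> 'a::field) set \<Rightarrow> (bool \<times> int \<Rightarrow> 'a) set" where
  "interior_code n C = left_ideal_generated (dihedral_algebra n) (C \<inter> cyclic_subalgebra n)"

text \<open>The polynomials \<open>P\<close> and \<open>Q\<close> of degree less than \<open>n\<close> with \<open>u = P(a) + b Q(a)\<close>.\<close>

definition P_poly :: "nat \<Rightarrow> (bool \<times> int \<Rightarrow> 'a::field) \<Rightarrow> 'a poly" where
  "P_poly n u = (\<Sum>i<n. Polynomial.monom (u (False, int i)) i)"

definition Q_poly :: "nat \<Rightarrow> (bool \<times> int \<Rightarrow> 'a::field) \<Rightarrow> 'a poly" where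
  "Q_poly n u = (\<Sum>i<n. Polynomial.monom (u (True, int i)) i)"


section \<open>The Wedderburn decomposition\<close>

definition zeta :: "nat \<Rightarrow> nat" where
  "zeta n = (if even n then 2 else 1)"

text \<open>
  \<open>reflect_poly g\<close> is \<open>x\<^bsup>deg g\<^esup> g(1/x)\<close>; here it is rescaled to be monic.
\<close>

definition monic_reciprocal :: "'a::field poly \<Rightarrow> 'a poly" where
  "monic_reciprocal g =
    Polynomial.smult (inverse (Polynomial.lead_coeff (reflect_poly g))) (reflect_poly g)"

abbreviation eval_ac :: "'a::field poly \<Rightarrow> 'a alg_closure \<Rightarrow> 'a alg_closure" where
  "eval_ac p z \<equiv> poly (map_poly to_ac p) z"

definition adjoin :: "'a::field alg_closure \<Rightarrow> 'a alg_closure set" where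
  "adjoin z = range (\<lambda>p :: 'a poly. eval_ac p z)"

text \<open>All fields \<open>F\<^sub>j\<close> are taken inside the algebraic closure of the ground field.\<close>

definition F_field :: "nat \<Rightarrow> nat \<Rightarrow> (nat \<Rightarrow> 'a::field alg_closure) \<Rightarrow> nat \<Rightarrow> 'a alg_closure set" where
  "F_field n r \<alpha> j =
    (if j \<le> zeta n then range to_ac
     else if j \<le> r then adjoin (\<alpha> j + inverse (\<alpha> j))
     else adjoin (\<alpha> j))"

text \<open>
  The cyclic group of order 2 is \<open>{0, 1}\<close> with addition modulo 2, so \<open>h\<close> is \<open>1\<close> and
  \<open>hcomb x y\<close> is \<open>x + y h\<close>.
\<close>

definition C2_algebra :: "(int \<Rightarrow> 'a::field alg_closure) ring" where
  "C2_algebra = group_algebra (range to_ac) (integer_mod_group 2)"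

definition hcomb :: "'k \<Rightarrow> 'k \<Rightarrow> int \<Rightarrow> 'k" where
  "hcomb x y = (\<lambda>i\<in>carrier (integer_mod_group 2). if i = 0 then x else y)"

definition mat2 :: "'k::zero \<Rightarrow> 'k \<Rightarrow> 'k \<Rightarrow> 'k \<Rightarrow> 'k^2^2" where
  "mat2 x y z w = vector [vector [x, y], vector [z, w]]"

text \<open>
  Components are elements of a disjoint sum: \<open>Inl\<close> for the group algebra of the cyclic group of
  order 2, \<open>Inr\<close> for matrices. A direct sum of components is an extensional product over
  \<open>{1..r+s}\<close>.
\<close>

type_synonym 'a component = "(int \<Rightarrow> 'a alg_closure) + ('a alg_closure)^2^2"

definition A_comp :: "nat \<Rightarrow> nat \<Rightarrow> (nat \<Rightarrow> 'a::field alg_closure) \<Rightarrow> nat \<Rightarrow> 'a component set" where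
  "A_comp n r \<alpha> j =
    (if j \<le> zeta n then Inl ` carrier C2_algebra
     else Inr ` {M. \<forall>i k. M $ i $ k \<in> F_field n r \<alpha> j})"

definition I_comp :: "nat \<Rightarrow> nat \<Rightarrow> (nat \<Rightarrow> 'a::field alg_closure) \<Rightarrow> nat
    \<Rightarrow> 'a alg_closure \<Rightarrow> 'a alg_closure \<Rightarrow> 'a component set" where
  "I_comp n r \<alpha> j x y =
    (if j \<le> zeta n
     then Inl ` {w \<otimes>\<^bsub>C2_algebra\<^esub> hcomb (x + y) (x - y) | w. w \<in> carrier C2_algebra}
     else Inr ` {mat2 (k * y) (- (k * x)) (t * y) (- (t * x)) | k t.
                   k \<in> F_field n r \<alpha> j \<and> t \<in> F_field n r \<alpha> j})"

definition zero_comp :: "nat \<Rightarrow> nat \<Rightarrow> 'a::field component set" where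
  "zero_comp n j = (if j \<le> zeta n then {Inl \<zero>\<^bsub>C2_algebra\<^esub>} else {Inr 0})"

definition gamma_map :: "nat \<Rightarrow> nat \<Rightarrow> (bool \<times> int \<Rightarrow> 'a::field) \<Rightarrow> int \<Rightarrow> 'a alg_closure" where
  "gamma_map n j u =
    (let c = (if j = 1 then 1 else - 1)
     in hcomb (to_ac (poly (P_poly n u) c)) (to_ac (poly (Q_poly n u) c)))"

definition tau_map :: "nat \<Rightarrow> 'a alg_closure \<Rightarrow> (bool \<times> int \<Rightarrow> 'a::field) \<Rightarrow> 'a alg_closure^2^2" where
  "tau_map n z u =
    mat2 (eval_ac (P_poly n u) z) (eval_ac (Q_poly n u) (inverse z))
         (eval_ac (Q_poly n u) z) (eval_ac (P_poly n u) (inverse z))"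

definition sigma_map :: "'a alg_closure \<Rightarrow> 'a::field alg_closure^2^2 \<Rightarrow> 'a alg_closure^2^2" where
  "sigma_map z M =
    (let Z = mat2 1 (- z) 1 (- inverse z) in matrix_inv Z ** M ** Z)"

definition P_comp :: "nat \<Rightarrow> nat \<Rightarrow> (nat \<Rightarrow> 'a::field alg_closure) \<Rightarrow> nat
    \<Rightarrow> (bool \<times> int \<Rightarrow> 'a) \<Rightarrow> 'a component" where
  "P_comp n r \<alpha> j u =
    (if j \<le> zeta n then Inl (gamma_map n j u)
     else if j \<le> r then Inr (sigma_map (\<alpha> j) (tau_map n (\<alpha> j) u))
     else Inr (tau_map n (\<alpha> j) u))"

definition P_map :: "nat \<Rightarrow> nat \<Rightarrow> nat \<Rightarrow> (nat \<Rightarrow> 'a::field alg_closure)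
    \<Rightarrow> (bool \<times> int \<Rightarrow> 'a) \<Rightarrow> nat \<Rightarrow> 'a component" where
  "P_map n r s \<alpha> u = (\<lambda>j\<in>{1..r+s}. P_comp n r \<alpha> j u)"

end

theory Submission
  imports Defs "HOL-Number_Theory.Residues"
begin

text \<open>
  An element of the cyclic subalgebra is a polynomial \<open>P(a)\<close> in the rotation, so its matrix \<open>\<tau>\<close> at
  \<open>\<alpha> j\<close> is \<open>diag(P(\<alpha> j), P(\<alpha> j\<^bsup>-1\<^esup>))\<close>. If such a diagonal matrix lies in a proper left ideal that
  occurs as a component of a code, it is zero (lemma \<open>rotation_component_zero\<close>), with one exception: at a
  reciprocal pair of factors the two diagonal entries are independent of each other, and the left
  ideals \<open>I_j(0,1)\<close> and \<open>I_j(1,0)\<close> are generated by \<open>diag(1, 0)\<close> and \<open>diag(0, 1)\<close>.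
  At a self-reciprocal factor the two entries are conjugate, hence vanish together. So the
  intersection of the code \<open>C\<close> with the cyclic subalgebra, and with it the left ideal generated by it,
  has zero components outside \<open>K = K\<^sub>1 \<union> K\<^sub>2 \<union> K\<^sub>3\<close>.

  Conversely, there is a polynomial \<open>p\<close> that is 1 or 0 at the roots of each irreducible factor of
  \<open>x\<^bsup>n\<^esup> - 1\<close>, as prescribed (lemma \<open>factor_indicator_poly\<close>). Prescribing it so that the components of
  \<open>e = p(a)\<close> are the identity for \<open>j \<in> K\<^sub>1\<close>, \<open>diag(1, 0)\<close> for \<open>j \<in> K\<^sub>2\<close>, \<open>diag(0, 1)\<close> for
  \<open>j \<in> K\<^sub>3\<close> and zero elsewhere gives an element of \<open>C\<close>, because \<open>P\<close> is injective
  (lemma \<open>tau_map_jointly_injective\<close>). Each \<open>u \<in> C\<close> with zero components outside \<open>K\<close> satisfies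
  \<open>P(u e) = P(u)\<close>, and \<open>u e\<close> lies in the left ideal generated by \<open>e\<close>.
\<close>

(* The coefficient notation of formal power series makes every matrix entry ambiguous to parse. *)
no_notation fps_nth (infixl "$" 75)

section \<open>Evaluating polynomials in the algebraic closure\<close>

lemma map_poly_to_ac_mult:
  "map_poly to_ac (p * q) = map_poly to_ac p * map_poly to_ac q"
  by (rule poly_eqI) (simp add: coeff_map_poly Polynomial.coeff_mult to_ac_sum)

lemma map_poly_to_ac_add:
  "map_poly to_ac (p + q) = map_poly to_ac p + map_poly to_ac q"
  by (rule poly_eqI) (simp add: coeff_map_poly)

lemma map_poly_to_ac_diff:
  "map_poly to_ac (p - q) = map_poly to_ac p - map_poly to_ac q"
  by (rule poly_eqI) (simp add: coeff_map_poly)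

lemma degree_map_poly_to_ac: "Polynomial.degree (map_poly to_ac p) = Polynomial.degree p"
  by (rule degree_map_poly) simp

lemma reflect_poly_map_poly_to_ac:
  "map_poly to_ac (reflect_poly p) = reflect_poly (map_poly to_ac p)"
  by (rule poly_eqI) (simp add: coeff_map_poly coeff_reflect_poly degree_map_poly_to_ac)

lemma eval_ac_simps [simp]:
  "eval_ac (p + q) z = eval_ac p z + eval_ac q z"
  "eval_ac (p - q) z = eval_ac p z - eval_ac q z"
  "eval_ac (p * q) z = eval_ac p z * eval_ac q z"
  by (simp_all add: map_poly_to_ac_add map_poly_to_ac_diff map_poly_to_ac_mult)

lemma eval_ac_power [simp]: "eval_ac (p ^ k) z = eval_ac p z ^ k"
  by (induction k) auto

lemma eval_ac_monom [simp]: "eval_ac (Polynomial.monom c k) z = to_ac c * z ^ k"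
  by (simp add: map_poly_monom poly_monom)

lemma eval_ac_smult [simp]: "eval_ac (Polynomial.smult c p) z = to_ac c * eval_ac p z"
  by (simp add: map_poly_smult)

lemma eval_ac_sum: "eval_ac (\<Sum>i\<in>A. p i) z = (\<Sum>i\<in>A. eval_ac (p i) z)"
  by (induction A rule: infinite_finite_induct) auto

lemma eval_ac_prod: "eval_ac (\<Prod>i\<in>A. p i) z = (\<Prod>i\<in>A. eval_ac (p i) z)"
  by (induction A rule: infinite_finite_induct) auto

lemma eval_ac_to_ac: "eval_ac p (to_ac c) = to_ac (poly p c)"
  by (induction p) (simp_all add: map_poly_pCons)

lemma eval_ac_reflect_eq_0_iff:
  "z \<noteq> 0 \<Longrightarrow> eval_ac (reflect_poly p) z = 0 \<longleftrightarrow> eval_ac p (inverse z) = 0"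
  by (simp add: reflect_poly_map_poly_to_ac poly_reflect_poly_nz)

lemma eval_ac_monic_reciprocal_eq_0_iff:
  assumes "z \<noteq> 0" "p \<noteq> 0"
  shows "eval_ac (monic_reciprocal p) z = 0 \<longleftrightarrow> eval_ac p (inverse z) = 0"
  using assms by (simp add: monic_reciprocal_def eval_ac_reflect_eq_0_iff)

text \<open>
  A polynomial of least degree vanishing at \<open>z\<close> divides everything that vanishes at \<open>z\<close>; it divides
  the irreducible \<open>g\<close>, so it is \<open>g\<close> up to a unit, and \<open>p\<close> is a multiple of \<open>g\<close>. This is
  how a condition at one root is carried to the conjugate roots without any Galois theory.
\<close>

lemma irreducible_roots_conjugate:
  fixes g p :: "'a::field poly"
  assumes irr: "Factorial_Ring.irreducible g"
    and g: "eval_ac g z = 0" "eval_ac g w = 0" and p: "eval_ac p z = 0"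
  shows "eval_ac p w = 0"
proof -
  have "\<exists>m. m \<noteq> 0 \<and> eval_ac m z = 0"
    using irr g(1) by (intro exI[of _ g]) (auto simp: Factorial_Ring.irreducible_def)
  then obtain m where m: "m \<noteq> 0" "eval_ac m z = 0"
    and min: "\<And>l. l \<noteq> 0 \<and> eval_ac l z = 0 \<Longrightarrow> Polynomial.degree m \<le> Polynomial.degree l"
    using ex_has_least_nat[of "\<lambda>m. m \<noteq> 0 \<and> eval_ac m z = 0" _ Polynomial.degree] by blast
  have dvd: "m dvd l" if "eval_ac l z = 0" for l
  proof -
    have "eval_ac (l mod m) z = 0"
      using that m by (simp flip: minus_mult_div_eq_mod)
    with min[of "l mod m"] degree_mod_less[OF m(1), of l] show ?thesis
      by (cases "l mod m = 0") (auto simp: dvd_eq_mod_eq_0)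
  qed
  from dvd[OF g(1)] obtain k where k: "g = m * k" by (elim dvdE)
  have "\<not> m dvd 1"
    using m by (auto elim!: dvdE dest!: arg_cong[of 1 _ "\<lambda>l. eval_ac l z"])
  with irr k have "k dvd 1" by (auto dest: Factorial_Ring.irreducibleD)
  then have "g dvd m"
    using k by (simp add: mult_unit_dvd_iff)
  with dvd[OF p] have "g dvd p" by (rule dvd_trans[rotated])
  with g(2) show ?thesis by (auto elim!: dvdE)
qed

section \<open>Polynomials and the roots of unity of order \<open>n\<close>\<close>

lemma degree_roots_of_unity_poly:
  "n > 0 \<Longrightarrow> Polynomial.degree (Polynomial.monom 1 n - 1 :: 'k::field poly) = n"
  using degree_add_eq_left[of "- 1 :: 'k poly" "Polynomial.monom 1 n"]
  by (simp add: Polynomial.degree_monom_eq)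

text \<open>
  The derivative \<open>n x\<^bsup>n-1\<^esup>\<close> of \<open>x\<^bsup>n\<^esup> - 1\<close> does not vanish at a root of unity.
\<close>

lemma roots_of_unity_simple:
  fixes g h :: "'k::field poly"
  assumes "g * h = Polynomial.monom 1 n - 1" "of_nat n \<noteq> (0::'k)" "poly g z = 0"
  shows "poly h z \<noteq> 0"
proof
  assume h: "poly h z = 0"
  have n: "n > 0" using assms(2) by (cases n) auto
  have "poly (pderiv (g * h)) z = 0"
    using assms(3) h by (simp add: pderiv_mult)
  then have "of_nat n * z ^ (n - 1) = 0"
    using assms(1) by (simp add: pderiv_diff pderiv_monom poly_monom)
  with assms(2) have "z = 0" by (cases "n - 1") auto
  moreover have "z ^ n = 1"
    using arg_cong[OF assms(1), of "\<lambda>p. poly p z"] assms(3) by (simp add: poly_monom)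
  ultimately show False using n by (simp add: power_0_left)
qed

text \<open>
  One root at a time is split off from both polynomials; since the roots of \<open>p\<close> are simple, the root
  that was split off is not a root of the remaining cofactor of \<open>p\<close>.
\<close>

lemma separable_dvd:
  fixes p d :: "'k::alg_closed_field poly"
  assumes "p \<noteq> 0" "\<And>z. poly p z = 0 \<Longrightarrow> poly (pderiv p) z \<noteq> 0"
    "\<And>z. poly p z = 0 \<Longrightarrow> poly d z = 0"
  shows "p dvd d"
  using assms
proof (induction "Polynomial.degree p" arbitrary: p d)
  case 0
  then show ?case by (simp add: is_unit_iff_degree unit_imp_dvd)
next
  case (Suc k)
  then obtain a where a: "poly p a = 0"
    using alg_closed_imp_poly_has_root[of p] by auto
  then obtain q where q: "p = [:- a, 1:] * q" by (auto simp: poly_eq_0_iff_dvd elim: dvdE)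
  from Suc.prems(3)[OF a] obtain e where e: "d = [:- a, 1:] * e"
    by (auto simp: poly_eq_0_iff_dvd elim: dvdE)
  have deriv: "pderiv p = q + [:- a, 1:] * pderiv q"
    unfolding q pderiv_mult by (simp add: pderiv_pCons add.commute)
  have "q dvd e"
  proof (rule Suc.hyps(1))
    show "k = Polynomial.degree q" "q \<noteq> 0"
      using Suc.hyps(2) Suc.prems(1) by (auto simp: q degree_mult_eq simp del: mult_pCons_left)
  next
    fix z assume z: "poly q z = 0"
    with Suc.prems(2)[of z] show "poly (pderiv q) z \<noteq> 0" unfolding deriv by (auto simp: q)
    from z Suc.prems(2)[of z] have "z \<noteq> a" unfolding deriv by (auto simp: q)
    with Suc.prems(3)[of z] z show "poly e z = 0" by (simp add: q e)
  qed
  then show ?case unfolding q e by (rule mult_dvd_mono[OF dvd_refl])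
qed

lemma vanishing_on_roots_of_unity:
  fixes p :: "'a::field poly"
  assumes n: "of_nat n \<noteq> (0::'a)" and deg: "Polynomial.degree p < n"
    and van: "\<And>z. z ^ n = 1 \<Longrightarrow> eval_ac p z = 0"
  shows "p = 0"
proof -
  have n': "of_nat n \<noteq> (0::'a alg_closure)"
    using n by (metis to_ac_eq_0_iff to_ac_of_nat)
  let ?X = "Polynomial.monom 1 n - 1 :: 'a alg_closure poly"
  have degX: "Polynomial.degree ?X = n"
    using deg by (intro degree_roots_of_unity_poly) auto
  then have X0: "?X \<noteq> 0" using deg by auto
  have "?X dvd map_poly to_ac p"
  proof (rule separable_dvd[OF X0])
    fix z assume z: "poly ?X z = 0"
    then have zn: "z ^ n = 1" by (simp add: poly_monom)
    then have "z \<noteq> 0" using deg by (auto simp: power_0_left)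
    then show "poly (pderiv ?X) z \<noteq> 0"
      using n' by (simp add: pderiv_diff pderiv_monom poly_monom)
    show "poly (map_poly to_ac p) z = 0" using van[OF zn] .
  qed
  then have "map_poly to_ac p = 0"
    using deg degX dvd_imp_degree_le[of ?X "map_poly to_ac p"]
    by (auto simp: degree_map_poly_to_ac)
  then show ?thesis by (simp add: map_poly_eq_0_iff)
qed

lemma finite_polys_degree_less:
  "finite {p :: 'a::{field,finite} poly. Polynomial.degree p < n}"
proof (rule finite_subset)
  show "{p :: 'a poly. Polynomial.degree p < n} \<subseteq> Poly ` {xs. set xs \<subseteq> UNIV \<and> length xs \<le> n}"
  proof
    fix p :: "'a poly" assume "p \<in> {p. Polynomial.degree p < n}"
    then have "length (coeffs p) \<le> n" by (cases "p = 0") (auto simp: length_coeffs_degree)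
    then show "p \<in> Poly ` {xs. set xs \<subseteq> UNIV \<and> length xs \<le> n}"
      by (intro image_eqI[of _ _ "coeffs p"]) auto
  qed
  show "finite (Poly ` {xs :: 'a list. set xs \<subseteq> UNIV \<and> length xs \<le> n})"
    by (intro finite_imageI finite_lists_length_le) simp
qed

text \<open>
  This takes the place of the Chinese remainder theorem. There are finitely many residues modulo
  \<open>x\<^bsup>n\<^esup> - 1\<close>, so two powers \<open>g\<^bsup>i\<^esup>\<close> and \<open>g\<^bsup>j\<^esup>\<close> with \<open>i < j\<close> are congruent, and at every root of
  unity where \<open>g\<close> does not vanish \<open>g\<^bsup>j-i\<^esup>\<close> takes the value 1.
\<close>

lemma nonzero_indicator_poly:
  fixes g :: "'a::{field,finite} poly"
  assumes n: "n > 0"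
  obtains e where "Polynomial.degree e < n"
    "\<And>z. z ^ n = 1 \<Longrightarrow> eval_ac e z = (if eval_ac g z = 0 then 0 else 1)"
proof -
  let ?X = "Polynomial.monom 1 n - 1 :: 'a poly"
  have degX: "Polynomial.degree ?X = n"
    using n by (rule degree_roots_of_unity_poly)
  then have X0: "?X \<noteq> 0" using n by auto
  have red_deg: "Polynomial.degree (p mod ?X) < n" for p
    using degree_mod_less[OF X0, of p] n degX by auto
  have red_eval: "eval_ac (p mod ?X) z = eval_ac p z" if "z ^ n = 1" for p z
    using that by (simp flip: minus_mult_div_eq_mod)
  have "\<not> inj (\<lambda>i::nat. g ^ i mod ?X)"
  proof
    assume "inj (\<lambda>i::nat. g ^ i mod ?X)"
    moreover have "finite (range (\<lambda>i::nat. g ^ i mod ?X))"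
      by (rule finite_subset[OF _ finite_polys_degree_less[of n]]) (auto simp: red_deg)
    ultimately show False using finite_imageD by blast
  qed
  then obtain i j where ij: "i < j" "g ^ i mod ?X = g ^ j mod ?X"
    unfolding inj_on_def by (metis linorder_neqE_nat)
  show ?thesis
  proof (rule that[OF red_deg])
    fix z :: "'a alg_closure" assume z: "z ^ n = 1"
    have "eval_ac g z ^ i = eval_ac g z ^ j"
      using red_eval[OF z, of "g ^ i"] red_eval[OF z, of "g ^ j"] ij(2) by simp
    also have "\<dots> = eval_ac g z ^ i * eval_ac g z ^ (j - i)"
      using ij(1) by (simp flip: power_add)
    finally show "eval_ac (g ^ (j - i) mod ?X) z = (if eval_ac g z = 0 then 0 else 1)"
      using ij(1) by (auto simp: red_eval[OF z])
  qed
qed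

lemma of_nat_neq_0_if_coprime_card:
  assumes "gcd CARD('a::{field,finite}) n = 1"
  shows "of_nat n \<noteq> (0::'a)"
proof
  assume "of_nat n = (0::'a)"
  then have "CHAR('a) dvd gcd CARD('a) n"
    using CHAR_dvd_CARD[where 'a='a] by (simp add: of_nat_eq_0_iff_char_dvd)
  with assms show False by simp
qed

section \<open>Two by two matrices and conjugation by \<open>Z\<close>\<close>

lemma mat2_nth [simp]:
  "mat2 a b c d $ 1 $ 1 = a" "mat2 a b c d $ 1 $ 2 = b"
  "mat2 a b c d $ 2 $ 1 = c" "mat2 a b c d $ 2 $ 2 = d"
  unfolding mat2_def vector_2 by (rule refl)+

lemma matrix2_eq_iff:
  "(M :: 'k^2^2) = N \<longleftrightarrow>
    M $ 1 $ 1 = N $ 1 $ 1 \<and> M $ 1 $ 2 = N $ 1 $ 2 \<and> M $ 2 $ 1 = N $ 2 $ 1 \<and> M $ 2 $ 2 = N $ 2 $ 2"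
  unfolding vec_eq_iff forall_2 by blast

lemma mat2_eq_iff [simp]: "mat2 a b c d = mat2 a' b' c' d' \<longleftrightarrow> a = a' \<and> b = b' \<and> c = c' \<and> d = d'"
  unfolding matrix2_eq_iff mat2_nth by (rule refl)

lemma mat2_mult:
  fixes a :: "'k::semiring_1"
  shows "mat2 a b c d ** mat2 a' b' c' d' =
    mat2 (a * a' + b * c') (a * b' + b * d') (c * a' + d * c') (c * b' + d * d')"
  by (simp add: matrix2_eq_iff matrix_matrix_mult_def sum_2)

lemma mat2_0 [simp]: "mat2 0 0 0 0 = 0" by (simp add: matrix2_eq_iff)

lemma mat_1_eq_mat2: "mat 1 = mat2 1 0 0 1" by (simp add: matrix2_eq_iff mat_def)

lemma det_mat2: "det (mat2 a b c d :: 'k::field^2^2) = a * d - b * c"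
  by (simp add: det_2)

lemma matrix_mult_0 [simp]:
  "(0 :: 'k::semiring_1^'n^'m) ** (A :: 'k^'l^'n) = 0" "(B :: 'k^'n^'m) ** (0 :: 'k::semiring_1^'l^'n) = 0"
  by (simp_all add: vec_eq_iff matrix_matrix_mult_def)

text \<open>
  The determinant of \<open>Z\<close> is \<open>z - z\<^bsup>-1\<^esup>\<close>. In this form the inner automorphism can be used
  without its matrix: it is injective, fixes the identity and preserves determinants.
\<close>

lemma sigma_map_conjugation:
  fixes z :: "'a::field alg_closure"
  assumes "z \<noteq> inverse z"
  obtains U V where "V ** U = mat 1" "U ** V = mat 1" "\<And>M. sigma_map z M = V ** M ** U"
proof -
  let ?Z = "mat2 1 (- z) 1 (- inverse z)"
  have "invertible ?Z"
    using assms by (simp add: invertible_det_nz det_mat2)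
  then have "?Z ** matrix_inv ?Z = mat 1 \<and> matrix_inv ?Z ** ?Z = mat 1"
    unfolding invertible_def matrix_inv_def by (rule someI_ex)
  then show ?thesis by (intro that[of "matrix_inv ?Z" ?Z]) (auto simp: sigma_map_def Let_def)
qed

lemma sigma_map_0 [simp]: "sigma_map z 0 = 0"
  by (simp add: sigma_map_def Let_def)

lemma sigma_map_eq_iff:
  assumes "z \<noteq> inverse z"
  shows "sigma_map z M = sigma_map z N \<longleftrightarrow> M = N"
proof
  obtain U V where UV: "V ** U = mat 1" "U ** V = mat 1" "\<And>M. sigma_map z M = V ** M ** U"
    using sigma_map_conjugation[OF assms] by blast
  assume "sigma_map z M = sigma_map z N"
  then have "U ** (V ** M ** U) ** V = U ** (V ** N ** U) ** V" by (simp add: UV)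
  moreover have "U ** (V ** W ** U) ** V = W" for W
  proof -
    have "U ** (V ** W ** U) ** V = (U ** V) ** W ** (U ** V)"
      by (simp only: matrix_mul_assoc)
    then show ?thesis by (simp add: UV)
  qed
  ultimately show "M = N" by simp
qed auto

lemma sigma_map_1:
  assumes "z \<noteq> inverse z"
  shows "sigma_map z (mat 1) = mat 1"
proof -
  obtain U V where UV: "V ** U = mat 1" "U ** V = mat 1" "\<And>M. sigma_map z M = V ** M ** U"
    using sigma_map_conjugation[OF assms] by blast
  then show ?thesis by simp
qed

lemma det_sigma_map:
  assumes "z \<noteq> inverse z"
  shows "det (sigma_map z M) = det M"
proof -
  obtain U V where UV: "V ** U = mat 1" "U ** V = mat 1" "\<And>M. sigma_map z M = V ** M ** U"
    using sigma_map_conjugation[OF assms] by blast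
  have "det V * det U = 1" using arg_cong[OF UV(1), of det] by (simp add: det_mul)
  then show ?thesis by (simp add: UV det_mul mult_ac)
qed

section \<open>The representations \<open>\<tau>\<close> of the dihedral group algebra\<close>

text \<open>
  Substituting \<open>g = x y\<close> in the convolution shows that the linear extension of a matrix representation
  to the group algebra is multiplicative. The formula is written entry by entry because
  scalar multiplication is at hand for the entries of a matrix, not for the matrix as a whole.
\<close>

lemma group_algebra_rep_mult:
  fixes G (structure) and \<rho> :: "'g \<Rightarrow> 'a::field alg_closure^'m::finite^'m"
  assumes G: "group G" and fin: "finite (carrier G)"
    and rep: "\<And>x y. x \<in> carrier G \<Longrightarrow> y \<in> carrier G \<Longrightarrow> \<rho> (x \<otimes> y) = \<rho> x ** \<rho> y"
  shows "(\<Sum>g\<in>carrier G. to_ac ((u \<otimes>\<^bsub>group_algebra K G\<^esub> v) g) * \<rho> g $ i $ k) =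
    (\<Sum>l\<in>UNIV. (\<Sum>x\<in>carrier G. to_ac (u x) * \<rho> x $ i $ l) * (\<Sum>y\<in>carrier G. to_ac (v y) * \<rho> y $ l $ k))"
proof -
  interpret group G by fact
  have "(\<Sum>g\<in>carrier G. to_ac ((u \<otimes>\<^bsub>group_algebra K G\<^esub> v) g) * \<rho> g $ i $ k) =
      (\<Sum>g\<in>carrier G. \<Sum>x\<in>carrier G. to_ac (u x) * to_ac (v (inv x \<otimes> g)) * \<rho> g $ i $ k)"
    by (simp add: group_algebra_def to_ac_sum sum_distrib_right)
  also have "\<dots> = (\<Sum>x\<in>carrier G. \<Sum>g\<in>carrier G. to_ac (u x) * to_ac (v (inv x \<otimes> g)) * \<rho> g $ i $ k)"
    by (rule sum.swap)
  also have "\<dots> = (\<Sum>x\<in>carrier G. \<Sum>y\<in>carrier G. to_ac (u x) * to_ac (v y) * \<rho> (x \<otimes> y) $ i $ k)"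
  proof (rule sum.cong[OF refl])
    fix x assume x: "x \<in> carrier G"
    show "(\<Sum>g\<in>carrier G. to_ac (u x) * to_ac (v (inv x \<otimes> g)) * \<rho> g $ i $ k) =
        (\<Sum>y\<in>carrier G. to_ac (u x) * to_ac (v y) * \<rho> (x \<otimes> y) $ i $ k)"
      by (rule sum.reindex_bij_witness[where i = "\<lambda>y. x \<otimes> y" and j = "\<lambda>g. inv x \<otimes> g"])
        (use x in \<open>auto simp: m_assoc[symmetric]\<close>)
  qed
  also have "\<dots> = (\<Sum>x\<in>carrier G. \<Sum>y\<in>carrier G. \<Sum>l\<in>UNIV.
      (to_ac (u x) * \<rho> x $ i $ l) * (to_ac (v y) * \<rho> y $ l $ k))"
    by (intro sum.cong refl) (simp add: rep matrix_matrix_mult_def sum_distrib_left mult_ac)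
  also have "\<dots> = (\<Sum>x\<in>carrier G. \<Sum>l\<in>UNIV. \<Sum>y\<in>carrier G.
      (to_ac (u x) * \<rho> x $ i $ l) * (to_ac (v y) * \<rho> y $ l $ k))"
    by (intro sum.cong refl sum.swap)
  also have "\<dots> = (\<Sum>l\<in>UNIV. \<Sum>x\<in>carrier G. \<Sum>y\<in>carrier G.
      (to_ac (u x) * \<rho> x $ i $ l) * (to_ac (v y) * \<rho> y $ l $ k))"
    by (rule sum.swap)
  finally show ?thesis by (simp only: sum_product)
qed

text \<open>
  The representation with \<open>a \<mapsto> diag(z, z\<^bsup>-1\<^esup>)\<close> and \<open>b\<close> the exchange of the coordinates, whose linear
  extension is \<open>\<tau>\<close>.
\<close>

definition dihedral_rep :: "'k::field \<Rightarrow> bool \<times> int \<Rightarrow> 'k^2^2" where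
  "dihedral_rep z g =
    (if fst g then mat2 0 (z powi (- snd g)) (z powi snd g) 0
     else mat2 (z powi snd g) 0 0 (z powi (- snd g)))"

lemma power_int_mod_order:
  fixes z :: "'k::field"
  assumes "n > 0" "z ^ n = 1"
  shows "z powi (k mod int n) = z powi k"
proof -
  have z: "z \<noteq> 0" using assms by (auto simp: power_0_left)
  have "z powi k = z powi (int n * (k div int n) + k mod int n)" by simp
  also have "\<dots> = (z powi int n) powi (k div int n) * z powi (k mod int n)"
    using z by (subst power_int_add) (simp_all add: power_int_mult)
  also have "z powi int n = 1" using assms by simp
  finally show ?thesis by simp
qed

lemma dihedral_rep_mult:
  fixes z :: "'k::field"
  assumes n: "n > 0" and z: "z ^ n = 1"
  shows "dihedral_rep z (x \<otimes>\<^bsub>dihedral_group n\<^esub> y) = dihedral_rep z x ** dihedral_rep z y"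
proof -
  have z0: "z \<noteq> 0" using assms by (auto simp: power_0_left)
  have m: "z powi (k mod int n) = z powi k" "z powi (- (k mod int n)) = z powi (- k)" for k
    using power_int_mod_order[OF n z] by (simp_all add: power_int_minus)
  obtain e i e' i' where xy: "x = (e, i)" "y = (e', i')" by (cases x, cases y) auto
  have add: "z powi (k + l) = z powi k * z powi l" for k l
    using z0 by (simp add: power_int_add)
  show ?thesis
    unfolding xy
    by (cases e; cases e'; simp add: dihedral_rep_def dihedral_group_def mat2_mult m)
      (simp_all add: add power_int_minus power_int_diff z0 field_simps)
qed

lemma carrier_dihedral_algebra:
  "carrier (dihedral_algebra n) = (UNIV \<times> {0..<int n}) \<rightarrow>\<^sub>E UNIV"
  by (simp add: dihedral_algebra_def group_algebra_def dihedral_group_def)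

lemma eval_ac_P_poly: "eval_ac (P_poly n u) z = (\<Sum>i<n. to_ac (u (False, int i)) * z ^ i)"
  by (simp add: P_poly_def eval_ac_sum)

lemma eval_ac_Q_poly: "eval_ac (Q_poly n u) z = (\<Sum>i<n. to_ac (u (True, int i)) * z ^ i)"
  by (simp add: Q_poly_def eval_ac_sum)

lemma tau_map_eq_sum_rep:
  "tau_map n z u $ i $ k =
    (\<Sum>g\<in>carrier (dihedral_group n). to_ac (u g) * dihedral_rep z g $ i $ k)"
proof -
  have int_sum: "(\<Sum>j\<in>{0..<int n}. h j) = (\<Sum>j<n. h (int j))" for h :: "int \<Rightarrow> 'a alg_closure"
    by (rule sum.reindex_bij_witness[where i = int and j = nat]) auto
  have split: "(\<Sum>g\<in>carrier (dihedral_group n). h g) =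
      (\<Sum>j<n. h (False, int j)) + (\<Sum>j<n. h (True, int j))" for h :: "bool \<times> int \<Rightarrow> 'a alg_closure"
  proof -
    have "(\<Sum>g\<in>carrier (dihedral_group n). h g) = (\<Sum>e\<in>UNIV. \<Sum>j\<in>{0..<int n}. h (e, j))"
      by (simp add: dihedral_group_def sum.cartesian_product)
    then show ?thesis by (simp add: UNIV_bool int_sum)
  qed
  show ?thesis
    using exhaust_2[of i] exhaust_2[of k]
    by (auto simp: split tau_map_def eval_ac_P_poly eval_ac_Q_poly dihedral_rep_def power_int_minus
        power_inverse)
qed

lemma tau_map_mult:
  assumes "n > 0" "z ^ n = 1"
  shows "tau_map n z (u \<otimes>\<^bsub>dihedral_algebra n\<^esub> v) = tau_map n z u ** tau_map n z v"
proof -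
  have "finite (carrier (dihedral_group n))" by (simp add: dihedral_group_def)
  then show ?thesis
    by (simp add: vec_eq_iff tau_map_eq_sum_rep matrix_matrix_mult_def dihedral_algebra_def
        group_algebra_rep_mult[OF group_dihedral_group[OF assms(1)] _ dihedral_rep_mult[OF assms]])
qed

lemma tau_map_add:
  "tau_map n z (u \<oplus>\<^bsub>dihedral_algebra n\<^esub> v) = tau_map n z u + tau_map n z v"
  by (simp add: vec_eq_iff tau_map_eq_sum_rep dihedral_algebra_def group_algebra_def
      distrib_right sum.distrib)

lemma tau_map_zero: "tau_map n z \<zero>\<^bsub>dihedral_algebra n\<^esub> = 0"
  by (simp add: vec_eq_iff tau_map_eq_sum_rep dihedral_algebra_def group_algebra_def)

lemma ring_dihedral_algebra: "n > 0 \<Longrightarrow> ring (dihedral_algebra n)"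
  unfolding dihedral_algebra_def
  by (rule ring_group_algebra) (auto simp: group_dihedral_group, simp add: dihedral_group_def)

section \<open>The rotation subalgebra, left ideals, and the group algebra of order 2\<close>

lemma generate_rotation:
  assumes "n > 0"
  shows "generate (dihedral_group n) {rotation n} = {False} \<times> {0..<int n}"
proof
  have "g \<in> {False} \<times> {0..<int n}" if "g \<in> generate (dihedral_group n) {rotation n}" for g
    using that
  proof (induction rule: generate.induct)
    case (inv g)
    have "(False, (- 1) mod int n) \<otimes>\<^bsub>dihedral_group n\<^esub> rotation n = \<one>\<^bsub>dihedral_group n\<^esub>"
      by (simp add: dihedral_group_def rotation_def mod_simps)
    then have "inv\<^bsub>dihedral_group n\<^esub> (rotation n) = (False, (- 1) mod int n)"
      using assms by (intro group.inv_equality[OF group_dihedral_group]) (auto simp: dihedral_group_def rotation_def)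
    with inv assms show ?case by simp
  qed (use assms in \<open>auto simp: dihedral_group_def rotation_def\<close>)
  then show "generate (dihedral_group n) {rotation n} \<subseteq> {False} \<times> {0..<int n}" by blast
next
  have "(False, i) \<in> generate (dihedral_group n) {rotation n}" if "i \<in> {0..<int n}" for i
  proof -
    have "rotation n [^]\<^bsub>dihedral_group n\<^esub> k \<in> generate (dihedral_group n) {rotation n}" for k :: nat
    proof (induction k)
      case 0
      show ?case by (simp add: generate.one)
    next
      case (Suc k)
      then show ?case by (simp add: generate.eng generate.incl)
    qed
    from this[of "nat i"] show ?thesis using that by (simp add: rotation_pow[OF assms])
  qed
  then show "{False} \<times> {0..<int n} \<subseteq> generate (dihedral_group n) {rotation n}" by auto
qed

lemma cyclic_subalgebra_eq:
  assumes "n > 0"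
  shows "cyclic_subalgebra n =
    {u \<in> carrier (dihedral_algebra n). \<forall>i\<in>{0..<int n}. u (True, i) = 0}"
proof -
  have "carrier (dihedral_group n) - generate (dihedral_group n) {rotation n} = {True} \<times> {0..<int n}"
    by (auto simp: generate_rotation[OF assms]) (auto simp: dihedral_group_def)
  then show ?thesis by (simp add: cyclic_subalgebra_def)
qed

lemma Q_poly_cyclic_subalgebra:
  assumes "n > 0" "u \<in> cyclic_subalgebra n"
  shows "Q_poly n u = 0"
  using assms(2) by (simp add: cyclic_subalgebra_eq[OF assms(1)] Q_poly_def)

lemma coeff_P_poly: "Polynomial.coeff (P_poly n u) i = (if i < n then u (False, int i) else 0)"
  by (simp add: P_poly_def Polynomial.coeff_sum)

lemma coeff_Q_poly: "Polynomial.coeff (Q_poly n u) i = (if i < n then u (True, int i) else 0)"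
  by (simp add: Q_poly_def Polynomial.coeff_sum)

lemma dihedral_algebra_eqI:
  assumes "u \<in> carrier (dihedral_algebra n)" "v \<in> carrier (dihedral_algebra n)"
    and "P_poly n u = P_poly n v" "Q_poly n u = Q_poly n v"
  shows "u = v"
proof (rule PiE_ext)
  show "u \<in> (UNIV \<times> {0..<int n}) \<rightarrow>\<^sub>E UNIV" "v \<in> (UNIV \<times> {0..<int n}) \<rightarrow>\<^sub>E UNIV"
    using assms(1,2) by (simp_all add: carrier_dihedral_algebra)
  fix g :: "bool \<times> int" assume "g \<in> UNIV \<times> {0..<int n}"
  then obtain e i where g: "g = (e, int i)" "i < n"
    by (cases g) (auto elim!: zero_le_imp_eq_int[THEN exE])
  have "u (False, int i) = v (False, int i)" "u (True, int i) = v (True, int i)"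
    using assms(3,4)[THEN arg_cong, of "\<lambda>p. Polynomial.coeff p i"] g(2)
    by (simp_all add: coeff_P_poly coeff_Q_poly)
  then show "u g = v g" by (cases e) (auto simp: g)
qed

definition of_rotation_poly :: "nat \<Rightarrow> 'a::field poly \<Rightarrow> bool \<times> int \<Rightarrow> 'a" where
  "of_rotation_poly n p =
    (\<lambda>g\<in>UNIV \<times> {0..<int n}. if fst g then 0 else Polynomial.coeff p (nat (snd g)))"

lemma of_rotation_poly_in_cyclic_subalgebra:
  "n > 0 \<Longrightarrow> of_rotation_poly n p \<in> cyclic_subalgebra n"
  by (auto simp: cyclic_subalgebra_eq of_rotation_poly_def carrier_dihedral_algebra)

lemma P_poly_of_rotation_poly:
  assumes "Polynomial.degree p < n"
  shows "P_poly n (of_rotation_poly n p) = p"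
  by (rule poly_eqI) (use assms in \<open>auto simp: coeff_P_poly of_rotation_poly_def Polynomial.coeff_eq_0\<close>)

lemma tau_map_of_rotation_poly:
  assumes "Polynomial.degree p < n"
  shows "tau_map n z (of_rotation_poly n p) = mat2 (eval_ac p z) 0 0 (eval_ac p (inverse z))"
  using assms
  by (simp add: tau_map_def P_poly_of_rotation_poly Q_poly_cyclic_subalgebra
      of_rotation_poly_in_cyclic_subalgebra)

lemma mult_in_left_ideal_generated:
  "v \<in> carrier R \<Longrightarrow> a \<in> S \<Longrightarrow> v \<otimes>\<^bsub>R\<^esub> a \<in> left_ideal_generated R S"
  by (auto simp: left_ideal_generated_def left_ideal_def)

lemma left_ideal_generated_minimal:
  "left_ideal I R \<Longrightarrow> S \<subseteq> I \<Longrightarrow> left_ideal_generated R S \<subseteq> I"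
  by (auto simp: left_ideal_generated_def)

lemma zero_C2_algebra: "\<zero>\<^bsub>C2_algebra\<^esub> = hcomb 0 0"
  by (auto simp: C2_algebra_def group_algebra_def hcomb_def)

lemma hcomb_eq_iff [simp]: "hcomb a b = hcomb a' b' \<longleftrightarrow> a = a' \<and> b = b'"
proof
  assume "hcomb a b = hcomb a' b'"
  then have "hcomb a b 0 = hcomb a' b' 0" "hcomb a b 1 = hcomb a' b' 1" by simp_all
  then show "a = a' \<and> b = b'" by (simp add: hcomb_def)
qed simp

lemma carrier_C2_algebra:
  "carrier C2_algebra = {hcomb a b | a b. a \<in> range to_ac \<and> b \<in> range to_ac}"
proof -
  have c: "carrier (integer_mod_group 2) = {0, 1}" by (auto simp: carrier_integer_mod_group)
  show ?thesis
  proof (intro equalityI subsetI)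
    fix w :: "int \<Rightarrow> 'a alg_closure" assume "w \<in> carrier C2_algebra"
    then have w: "w \<in> {0, 1} \<rightarrow>\<^sub>E range to_ac" by (simp add: C2_algebra_def group_algebra_def c)
    then have "w = hcomb (w 0) (w 1)"
      by (auto simp: hcomb_def c PiE_def extensional_def fun_eq_iff)
    moreover have "w 0 \<in> range to_ac" "w 1 \<in> range to_ac" using w by auto
    ultimately show "w \<in> {hcomb a b | a b. a \<in> range to_ac \<and> b \<in> range to_ac}" by blast
  qed (auto simp: C2_algebra_def group_algebra_def c hcomb_def PiE_def extensional_def)
qed

lemma hcomb_mult:
  "hcomb a b \<otimes>\<^bsub>C2_algebra\<^esub> hcomb c d = hcomb (a * c + b * d) (a * d + b * c)"
proof -
  have c: "carrier (integer_mod_group 2) = {0, 1}" by (auto simp: carrier_integer_mod_group)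
  show ?thesis
    by (auto simp: C2_algebra_def group_algebra_def c hcomb_def fun_eq_iff)
qed

section \<open>The factorization and the components of \<open>P\<close>\<close>

locale dihedral_factorization =
  fixes n r s :: nat
    and f :: "nat \<Rightarrow> ('a::{field,finite}) poly"
    and \<alpha> :: "nat \<Rightarrow> 'a alg_closure"
  assumes n: "n \<ge> 2" and coprime: "gcd CARD('a) n = 1"
    and r: "zeta n \<le> r"
    and f1: "f 1 = [:- 1, 1:]"
    and f2: "even n \<longrightarrow> f 2 = [:1, 1:]"
    and irred: "\<forall>j\<in>{1..r+s}. Factorial_Ring.irreducible (f j)"
    and factorization: "Polynomial.monom 1 n - 1 =
      (\<Prod>j=1..r. f j) * (\<Prod>j=r+1..r+s. f j * monic_reciprocal (f j))"
    and self_reciprocal: "\<forall>j. 1 < j \<and> j \<le> r \<longrightarrow> reflect_poly (f j) = f j"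
    and root: "\<forall>j\<in>{1..r+s}. eval_ac (f j) (\<alpha> j) = 0"
begin

text \<open>
  An index for all the irreducible factors of \<open>x\<^bsup>n\<^esup> - 1\<close> at once: \<open>(j, False)\<close> stands for \<open>f j\<close> and
  \<open>(j, True)\<close> for its reciprocal partner.
\<close>

definition factor_index :: "(nat \<times> bool) set" where
  "factor_index = {1..r+s} \<times> {False} \<union> {r+1..r+s} \<times> {True}"

definition factor :: "nat \<times> bool \<Rightarrow> 'a poly" where
  "factor t = (if snd t then monic_reciprocal (f (fst t)) else f (fst t))"

lemma n_pos: "n > 0" using n by simp

lemma of_nat_n_neq_0: "of_nat n \<noteq> (0::'a)"
  using coprime by (rule of_nat_neq_0_if_coprime_card)

lemma of_nat_n_neq_0_ac: "of_nat n \<noteq> (0::'a alg_closure)"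
  using of_nat_n_neq_0 by (metis to_ac_eq_0_iff to_ac_of_nat)

lemma finite_factor_index: "finite factor_index"
  by (simp add: factor_index_def)

lemma prod_factor: "(\<Prod>t\<in>factor_index. factor t) = Polynomial.monom 1 n - 1"
proof -
  have slice: "(\<Prod>t\<in>A \<times> {e}. factor t) = (\<Prod>j\<in>A. factor (j, e))" for A e
    by (rule prod.reindex_bij_witness[where i = "\<lambda>j. (j, e)" and j = fst]) auto
  have "{1..r+s} = {1..r} \<union> {r+1..r+s}" by auto
  then have split: "(\<Prod>j=1..r+s. f j) = (\<Prod>j=1..r. f j) * (\<Prod>j=r+1..r+s. f j)"
    by (simp add: prod.union_disjoint)
  have "(\<Prod>t\<in>factor_index. factor t) =
      (\<Prod>t\<in>{1..r+s} \<times> {False}. factor t) * (\<Prod>t\<in>{r+1..r+s} \<times> {True}. factor t)"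
    unfolding factor_index_def by (rule prod.union_disjoint) auto
  also have "\<dots> = (\<Prod>j=1..r+s. f j) * (\<Prod>j=r+1..r+s. monic_reciprocal (f j))"
    unfolding slice by (simp add: factor_def)
  also have "\<dots> = Polynomial.monom 1 n - 1"
    unfolding factorization split prod.distrib by (simp only: mult.assoc)
  finally show ?thesis .
qed

lemma factor_root_unique:
  assumes "t \<in> factor_index" "t' \<in> factor_index" "eval_ac (factor t) z = 0" "eval_ac (factor t') z = 0"
  shows "t = t'"
proof (rule ccontr)
  assume "t \<noteq> t'"
  let ?h = "\<Prod>t\<in>factor_index - {t}. factor t"
  have "factor t * ?h = Polynomial.monom 1 n - 1"
    using prod.remove[OF finite_factor_index assms(1), of factor] prod_factor by simp
  then have "map_poly to_ac (factor t) * map_poly to_ac ?h = Polynomial.monom 1 n - 1"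
    by (metis map_poly_to_ac_diff map_poly_to_ac_mult map_poly_1' map_poly_monom to_ac_0 to_ac_1)
  then have "eval_ac ?h z \<noteq> 0"
    using of_nat_n_neq_0_ac assms(3) by (rule roots_of_unity_simple)
  then have "eval_ac (factor t') z \<noteq> 0"
    using finite_factor_index assms(2) \<open>t \<noteq> t'\<close> by (auto simp: eval_ac_prod)
  with assms(4) show False by simp
qed

lemma root_of_unity_iff: "z ^ n = 1 \<longleftrightarrow> (\<exists>t\<in>factor_index. eval_ac (factor t) z = 0)"
proof -
  have "(\<Prod>t\<in>factor_index. eval_ac (factor t) z) = z ^ n - 1"
    using arg_cong[OF prod_factor, of "\<lambda>p. eval_ac p z"] by (simp add: eval_ac_prod)
  then have "z ^ n = 1 \<longleftrightarrow> (\<Prod>t\<in>factor_index. eval_ac (factor t) z) = 0"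
    by simp
  then show ?thesis by (simp only: prod_zero_iff[OF finite_factor_index])
qed

lemma f_nonzero: "j \<in> {1..r+s} \<Longrightarrow> f j \<noteq> 0"
  using irred by (auto simp: Factorial_Ring.irreducible_def)

lemma alpha_root_of_unity: "j \<in> {1..r+s} \<Longrightarrow> \<alpha> j ^ n = 1"
  unfolding root_of_unity_iff
  by (rule bexI[of _ "(j, False)"]) (use root in \<open>auto simp: factor_def factor_index_def\<close>)

lemma alpha_nonzero: "j \<in> {1..r+s} \<Longrightarrow> \<alpha> j \<noteq> 0"
  using alpha_root_of_unity[of j] n_pos by (auto simp: power_0_left)

lemma zeta_pos: "zeta n \<ge> 1" by (simp add: zeta_def)

lemma alpha_1: "\<alpha> 1 = 1"
  using bspec[OF root, of 1] r zeta_pos f1 by (simp add: map_poly_pCons)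

lemma alpha_2: "even n \<Longrightarrow> \<alpha> 2 = - 1"
  using bspec[OF root, of 2] r f2 by (simp add: map_poly_pCons zeta_def add_eq_0_iff)

lemma alpha_small:
  "j \<in> {1..zeta n} \<Longrightarrow> \<alpha> j = to_ac (if j = 1 then 1 else - 1)"
  using alpha_1 alpha_2 by (cases "j = 1"; cases "j = 2") (auto simp: zeta_def split: if_splits)

lemma alpha_inverse_root:
  assumes "j \<in> {1..r}"
  shows "eval_ac (f j) (inverse (\<alpha> j)) = 0"
proof (cases "j = 1")
  case True
  then show ?thesis using alpha_1 f1 by (simp add: map_poly_pCons)
next
  case False
  then have "eval_ac (reflect_poly (f j)) (\<alpha> j) = 0"
    using assms self_reciprocal root by auto
  then show ?thesis using alpha_nonzero[of j] assms by (simp add: eval_ac_reflect_eq_0_iff)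
qed

lemma alpha_inverse_root_reciprocal:
  assumes "j \<in> {r+1..r+s}"
  shows "eval_ac (monic_reciprocal (f j)) (inverse (\<alpha> j)) = 0"
  using assms root alpha_nonzero[of j] f_nonzero[of j]
  by (simp add: eval_ac_monic_reciprocal_eq_0_iff)

lemma alpha_neq_inverse:
  assumes j: "j \<in> {zeta n + 1..r+s}"
  shows "\<alpha> j \<noteq> inverse (\<alpha> j)"
proof
  assume eq: "\<alpha> j = inverse (\<alpha> j)"
  have j': "j \<in> {1..r+s}" using j by auto
  have "\<alpha> j * \<alpha> j = 1" using eq alpha_nonzero[OF j'] by (metis right_inverse)
  then have cases: "\<alpha> j = 1 \<or> \<alpha> j = - 1" by (simp add: square_eq_1_iff)
  have uniq: "i = j" if "i \<in> {1..r+s}" "\<alpha> i = \<alpha> j" for i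
    using factor_root_unique[of "(i, False)" "(j, False)" "\<alpha> j"] that j'
      bspec[OF root that(1)] bspec[OF root j']
    by (simp add: factor_index_def factor_def)
  have "\<alpha> j \<noteq> 1"
    using uniq[of 1] alpha_1 j r zeta_pos by auto
  moreover have "\<alpha> j \<noteq> - 1"
  proof
    assume m: "\<alpha> j = - 1"
    show False
    proof (cases "even n")
      case True
      then show ?thesis using uniq[of 2] alpha_2 m j r by (auto simp: zeta_def)
    next
      case False
      then have "\<alpha> j = 1" using m alpha_root_of_unity[OF j'] by simp
      with \<open>\<alpha> j \<noteq> 1\<close> show False by simp
    qed
  qed
  ultimately show False using cases by blast
qed

text \<open>
  These polynomials, substituted at the rotation, are the idempotents of the algebra of
  the rotations: \<open>T\<close> selects the simple components on which the idempotent is 1. The polynomial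
  is the indicator of the nonvanishing of the product of the unselected factors.
\<close>

lemma factor_indicator_poly:
  obtains e where "Polynomial.degree e < n"
    "\<And>t z. t \<in> factor_index \<Longrightarrow> eval_ac (factor t) z = 0 \<Longrightarrow>
      eval_ac e z = (if t \<in> T then 1 else 0)"
proof -
  obtain e where e: "Polynomial.degree e < n"
    "\<And>z. z ^ n = 1 \<Longrightarrow> eval_ac e z =
      (if eval_ac (\<Prod>t\<in>factor_index - T. factor t) z = 0 then 0 else 1)"
    using nonzero_indicator_poly[OF n_pos] by blast
  show ?thesis
  proof (rule that[OF e(1)])
    fix t z assume t: "t \<in> factor_index" "eval_ac (factor t) z = 0"
    then have "z ^ n = 1" using root_of_unity_iff by blast
    moreover have "eval_ac (\<Prod>t\<in>factor_index - T. factor t) z = 0 \<longleftrightarrow>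
        (\<exists>t'\<in>factor_index - T. eval_ac (factor t') z = 0)"
      unfolding eval_ac_prod by (rule prod_zero_iff) (simp add: finite_factor_index)
    moreover have "\<dots> \<longleftrightarrow> t \<notin> T"
      using t factor_root_unique[OF t(1) _ t(2)] by blast
    ultimately show "eval_ac e z = (if t \<in> T then 1 else 0)" using e(2) by simp
  qed
qed

text \<open>
  The conjugates of all \<open>\<alpha> j\<close> and their inverses exhaust the roots of unity of order \<open>n\<close>. For a root
  \<open>z\<close> of a reciprocal partner it is \<open>z\<^bsup>-1\<^esup>\<close> that is conjugate to \<open>\<alpha> j\<close>, so there the
  polynomial is replaced by its reflection.
\<close>

lemma vanishing_at_alphas:
  fixes p :: "'a poly"
  assumes deg: "Polynomial.degree p < n"
    and van: "\<And>j. j \<in> {1..r+s} \<Longrightarrow> eval_ac p (\<alpha> j) = 0 \<and> eval_ac p (inverse (\<alpha> j)) = 0"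
  shows "p = 0"
proof (rule vanishing_on_roots_of_unity[OF of_nat_n_neq_0 deg])
  fix z :: "'a alg_closure" assume z: "z ^ n = 1"
  then have z0: "z \<noteq> 0" using n_pos by (auto simp: power_0_left)
  from z obtain t where t: "t \<in> factor_index" "eval_ac (factor t) z = 0"
    using root_of_unity_iff by blast
  define j where "j = fst t"
  have j: "j \<in> {1..r+s}" using t(1) by (auto simp: factor_index_def j_def)
  have irr: "Factorial_Ring.irreducible (f j)" "eval_ac (f j) (\<alpha> j) = 0" using j irred root by auto
  show "eval_ac p z = 0"
  proof (cases "snd t")
    case False
    then have "eval_ac (f j) z = 0" using t(2) by (simp add: factor_def j_def)
    then show ?thesis using irreducible_roots_conjugate[OF irr] van[OF j] by blast
  next
    case True
    then have "eval_ac (f j) (inverse z) = 0"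
      using t(2) f_nonzero[OF j] z0 by (simp add: factor_def j_def eval_ac_monic_reciprocal_eq_0_iff)
    moreover have "eval_ac (reflect_poly p) (\<alpha> j) = 0"
      using van[OF j] alpha_nonzero[OF j] by (simp add: eval_ac_reflect_eq_0_iff)
    ultimately have "eval_ac (reflect_poly p) (inverse z) = 0"
      using irreducible_roots_conjugate[OF irr] by blast
    then show ?thesis using z0 by (simp add: eval_ac_reflect_eq_0_iff)
  qed
qed

lemma degree_P_poly_less: "Polynomial.degree (P_poly n u) < n"
  using n_pos by (intro degree_lessI) (auto simp: coeff_P_poly)

lemma degree_Q_poly_less: "Polynomial.degree (Q_poly n u) < n"
  using n_pos by (intro degree_lessI) (auto simp: coeff_Q_poly)

text \<open>
  The injectivity of \<open>P\<close>, in terms of the matrices \<open>\<tau>\<close>.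
\<close>

lemma tau_map_jointly_injective:
  assumes uv: "u \<in> carrier (dihedral_algebra n)" "v \<in> carrier (dihedral_algebra n)"
    and eq: "\<And>j. j \<in> {1..r+s} \<Longrightarrow> tau_map n (\<alpha> j) u = tau_map n (\<alpha> j) v"
  shows "u = v"
proof (rule dihedral_algebra_eqI[OF uv])
  have "P_poly n u - P_poly n v = 0"
    using eq by (intro vanishing_at_alphas degree_diff_less degree_P_poly_less) (simp add: tau_map_def)
  then show "P_poly n u = P_poly n v" by simp
  have "Q_poly n u - Q_poly n v = 0"
    using eq by (intro vanishing_at_alphas degree_diff_less degree_Q_poly_less) (simp add: tau_map_def)
  then show "Q_poly n u = Q_poly n v" by simp
qed

text \<open>
  At \<open>\<alpha> j = \<plusminus>1\<close> the matrix \<open>\<tau>\<close> is circulant, and its first column is the element of the group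
  algebra of order 2. Hence \<open>\<tau>\<close> carries the same information as the component of \<open>P\<close> for every \<open>j\<close>,
  and the three kinds of components can be treated together.
\<close>

lemma P_comp_small:
  assumes "j \<in> {1..zeta n}"
  shows "P_comp n r \<alpha> j u = Inl (hcomb (tau_map n (\<alpha> j) u $ 1 $ 1) (tau_map n (\<alpha> j) u $ 2 $ 1))"
    "tau_map n (\<alpha> j) u $ 2 $ 2 = tau_map n (\<alpha> j) u $ 1 $ 1"
    "tau_map n (\<alpha> j) u $ 1 $ 2 = tau_map n (\<alpha> j) u $ 2 $ 1"
  using assms alpha_small[OF assms]
  by (simp_all add: P_comp_def gamma_map_def Let_def tau_map_def eval_ac_to_ac flip: to_ac_inverse)

lemma P_comp_eq_iff:
  assumes "j \<in> {1..r+s}"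
  shows "P_comp n r \<alpha> j u = P_comp n r \<alpha> j v \<longleftrightarrow> tau_map n (\<alpha> j) u = tau_map n (\<alpha> j) v"
proof (cases "j \<le> zeta n")
  case True
  then have "j \<in> {1..zeta n}" using assms by simp
  then show ?thesis by (auto simp: P_comp_small matrix2_eq_iff)
next
  case False
  then have "\<alpha> j \<noteq> inverse (\<alpha> j)" using alpha_neq_inverse assms by simp
  with False show ?thesis by (auto simp: P_comp_def sigma_map_eq_iff)
qed

lemma P_comp_in_zero_comp_iff:
  assumes "j \<in> {1..r+s}"
  shows "P_comp n r \<alpha> j u \<in> zero_comp n j \<longleftrightarrow> tau_map n (\<alpha> j) u = 0"
proof -
  let ?z = "\<zero>\<^bsub>dihedral_algebra n\<^esub> :: bool \<times> int \<Rightarrow> 'a"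
  have "tau_map n (\<alpha> j) ?z = 0" by (rule tau_map_zero)
  moreover from this have "zero_comp n j = {P_comp n r \<alpha> j ?z}"
    using assms by (auto simp: zero_comp_def P_comp_small zero_C2_algebra) (auto simp: P_comp_def)
  ultimately show ?thesis using P_comp_eq_iff[OF assms, of u ?z] by simp
qed

lemma singular_I_comp:
  "j > zeta n \<Longrightarrow> Inr N \<in> I_comp n r \<alpha> j x y \<Longrightarrow> det N = 0"
  by (auto simp: I_comp_def det_mat2)

text \<open>
  The heart of the theorem: for a rotation polynomial the matrix \<open>\<tau>\<close> is \<open>diag(a, b)\<close> with
  \<open>a = P(\<alpha> j)\<close> and \<open>b = P(\<alpha> j\<^bsup>-1\<^esup>)\<close>, and this is incompatible with most proper left
  ideals. In the group algebra of order 2 the element would be \<open>a\<close>, which is not a nonzero multiple of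
  \<open>1 \<plusminus> h\<close>. For a self-reciprocal factor, a matrix in a proper left ideal is singular, so \<open>a b = 0\<close>, and \<open>a\<close>
  and \<open>b\<close> vanish together because \<open>\<alpha> j\<close> and \<open>\<alpha> j\<^bsup>-1\<^esup>\<close> are conjugate. For a reciprocal pair the
  off-diagonal zeros force \<open>k = t = 0\<close> as soon as \<open>x\<close> and \<open>y\<close> are both nonzero.
\<close>

lemma rotation_component_zero:
  assumes u: "u \<in> cyclic_subalgebra n" and j: "j \<in> {1..r+s}"
    and comp: "P_comp n r \<alpha> j u \<in> I_comp n r \<alpha> j x y"
    and small: "j \<le> zeta n \<Longrightarrow> x = 0 \<and> y = 1 \<or> x = 1 \<and> y = 0"
    and large: "j > r \<Longrightarrow> x \<noteq> 0 \<and> y \<noteq> 0"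
  shows "tau_map n (\<alpha> j) u = 0"
proof -
  define a b where "a = eval_ac (P_poly n u) (\<alpha> j)" and "b = eval_ac (P_poly n u) (inverse (\<alpha> j))"
  have tau: "tau_map n (\<alpha> j) u = mat2 a 0 0 b"
    using Q_poly_cyclic_subalgebra[OF n_pos u] by (simp add: tau_map_def a_def b_def)
  consider "j \<le> zeta n" | "zeta n < j" "j \<le> r" | "zeta n < j" "r < j" by linarith
  then have "a = 0 \<and> b = 0"
  proof cases
    case 1
    then have jz: "j \<in> {1..zeta n}" using j by simp
    have ab: "b = a" using P_comp_small(2)[OF jz, of u] by (simp add: tau)
    from comp 1 obtain w where w: "w \<in> carrier C2_algebra"
      "hcomb a 0 = w \<otimes>\<^bsub>C2_algebra\<^esub> hcomb (x + y) (x - y)"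
      unfolding P_comp_small(1)[OF jz] by (auto simp: I_comp_def tau)
    then obtain c d where "hcomb a 0 = hcomb c d \<otimes>\<^bsub>C2_algebra\<^esub> hcomb (x + y) (x - y)"
      by (auto simp: carrier_C2_algebra)
    then have "a = c * (x + y) + d * (x - y)" "0 = c * (x - y) + d * (x + y)"
      by (simp_all add: hcomb_mult)
    with small[OF 1] have "a = 0" by auto
    with ab show ?thesis by simp
  next
    case 2
    have neq: "\<alpha> j \<noteq> inverse (\<alpha> j)" using 2 j by (intro alpha_neq_inverse) auto
    have "det (sigma_map (\<alpha> j) (mat2 a 0 0 b)) = 0"
      using comp 2 by (intro singular_I_comp[of j _ x y]) (auto simp: P_comp_def tau)
    then have prod: "a * b = 0" using neq by (simp add: det_sigma_map det_mat2)
    have irr: "Factorial_Ring.irreducible (f j)" using irred j by blast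
    have roots: "eval_ac (f j) (\<alpha> j) = 0" "eval_ac (f j) (inverse (\<alpha> j)) = 0"
      using root j alpha_inverse_root 2 by auto
    show ?thesis
      using prod irreducible_roots_conjugate[OF irr roots, of "P_poly n u"]
        irreducible_roots_conjugate[OF irr roots(2,1), of "P_poly n u"]
      by (auto simp: a_def b_def)
  next
    case 3
    then have "Inr (mat2 a 0 0 b) \<in> I_comp n r \<alpha> j x y"
      using comp by (simp add: P_comp_def tau)
    then show ?thesis using 3 large by (auto simp: I_comp_def)
  qed
  then show ?thesis by (simp add: tau)
qed

lemma F_field_0_1:
  shows "0 \<in> F_field n r \<alpha> j" "1 \<in> F_field n r \<alpha> j" "- 1 \<in> F_field n r \<alpha> j"
proof -
  have "to_ac c \<in> F_field n r \<alpha> j" for c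
    by (auto simp: F_field_def adjoin_def map_poly_pCons intro!: image_eqI[of _ _ "[:c:]"])
  from this[of 0] this[of 1] this[of "- 1"]
  show "0 \<in> F_field n r \<alpha> j" "1 \<in> F_field n r \<alpha> j" "- 1 \<in> F_field n r \<alpha> j" by simp_all
qed

lemma zero_comp_subset_A_comp: "zero_comp n j \<subseteq> A_comp n r \<alpha> j"
  using F_field_0_1[of j] by (force simp: zero_comp_def A_comp_def zero_C2_algebra carrier_C2_algebra)

lemma zero_comp_subset_I_comp: "zero_comp n j \<subseteq> I_comp n r \<alpha> j x y"
proof (cases "j \<le> zeta n")
  case True
  have "hcomb 0 0 \<in> (carrier C2_algebra :: (int \<Rightarrow> 'a alg_closure) set)"
    by (force simp: carrier_C2_algebra)
  moreover have "(hcomb 0 0 :: int \<Rightarrow> 'a alg_closure) = hcomb 0 0 \<otimes>\<^bsub>C2_algebra\<^esub> hcomb (x + y) (x - y)"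
    by (simp add: hcomb_mult)
  ultimately show ?thesis
    using True by (auto simp: zero_comp_def I_comp_def zero_C2_algebra)
next
  case False
  then show ?thesis
    using F_field_0_1(1)[of j] by (auto simp: zero_comp_def I_comp_def image_iff intro!: exI[of _ 0])
qed

lemma rotation_component_in_A_comp:
  assumes "j \<in> {1..r+s}" "tau_map n (\<alpha> j) u = mat 1"
  shows "P_comp n r \<alpha> j u \<in> A_comp n r \<alpha> j"
proof (cases "j \<le> zeta n")
  case True
  then have "j \<in> {1..zeta n}" using assms by simp
  then show ?thesis
    using True assms(2) by (force simp: P_comp_small A_comp_def carrier_C2_algebra mat_1_eq_mat2)
next
  case False
  then have "\<alpha> j \<noteq> inverse (\<alpha> j)" using alpha_neq_inverse assms by simp
  then have "P_comp n r \<alpha> j u = Inr (mat 1)"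
    using False assms(2) by (simp add: P_comp_def sigma_map_1)
  then show ?thesis
    using False F_field_0_1[of j] by (simp add: A_comp_def mat_def)
qed


section \<open>The image of the interior induced code\<close>

text \<open>
  The code \<open>C\<close> has the components \<open>B j\<close>, and the claimed components are \<open>B j\<close> for \<open>j \<in> K\<close> and
  zero otherwise. The bound from above holds because the elements of \<open>C\<close> whose components outside \<open>K\<close> vanish
  form a left ideal that contains the rotation part of \<open>C\<close>. For the bound from below a rotation
  polynomial \<open>e \<in> C\<close> is constructed such that right multiplication by \<open>e\<close> fixes every
  element with the claimed components.
\<close>

lemma P_map_interior_code:
  fixes C J\<^sub>1 J\<^sub>2 J\<^sub>3 J\<^sub>4 x
  assumes code: "left_ideal C (dihedral_algebra n)"
    and J4: "J\<^sub>4 \<subseteq> {zeta n + 1..r+s}"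
    and disj: "J\<^sub>1 \<inter> J\<^sub>2 = {}" "J\<^sub>1 \<inter> J\<^sub>3 = {}" "J\<^sub>1 \<inter> J\<^sub>4 = {}"
      "J\<^sub>2 \<inter> J\<^sub>3 = {}" "J\<^sub>2 \<inter> J\<^sub>4 = {}" "J\<^sub>3 \<inter> J\<^sub>4 = {}"
    and x: "\<And>j. j \<in> J\<^sub>4 \<Longrightarrow> x j \<noteq> 0"
    and image: "P_map n r s \<alpha> ` C =
      (\<Pi>\<^sub>E j\<in>{1..r+s}.
        if j \<in> J\<^sub>1 then A_comp n r \<alpha> j
        else if j \<in> J\<^sub>2 then I_comp n r \<alpha> j 0 1
        else if j \<in> J\<^sub>3 then I_comp n r \<alpha> j 1 0
        else if j \<in> J\<^sub>4 then I_comp n r \<alpha> j (- x j) 1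
        else zero_comp n j)"
    and K: "K\<^sub>2 = {j \<in> J\<^sub>2. r + 1 \<le> j \<and> j \<le> r + s}" "K\<^sub>3 = {j \<in> J\<^sub>3. r + 1 \<le> j \<and> j \<le> r + s}"
  shows "P_map n r s \<alpha> ` interior_code n C =
      (\<Pi>\<^sub>E j\<in>{1..r+s}.
        if j \<in> J\<^sub>1 then A_comp n r \<alpha> j
        else if j \<in> K\<^sub>2 then I_comp n r \<alpha> j 0 1
        else if j \<in> K\<^sub>3 then I_comp n r \<alpha> j 1 0
        else zero_comp n j)"
    (is "_ = Pi\<^sub>E _ ?B'")
proof -
  let ?D = "dihedral_algebra n :: (bool \<times> int \<Rightarrow> 'a) ring"
  define B where "B j =
     (if j \<in> J\<^sub>1 then A_comp n r \<alpha> j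
      else if j \<in> J\<^sub>2 then I_comp n r \<alpha> j 0 1
      else if j \<in> J\<^sub>3 then I_comp n r \<alpha> j 1 0
      else if j \<in> J\<^sub>4 then I_comp n r \<alpha> j (- x j) 1
      else zero_comp n j)" for j
  define K where "K = J\<^sub>1 \<union> K\<^sub>2 \<union> K\<^sub>3"
  have image: "P_map n r s \<alpha> ` C = Pi\<^sub>E {1..r+s} B" unfolding image B_def ..
  have B': "?B' j = (if j \<in> K then B j else zero_comp n j)" for j
    using disj by (auto simp: B_def K_def K)
  have zero_B: "zero_comp n j \<subseteq> B j" for j
    by (simp add: B_def zero_comp_subset_A_comp zero_comp_subset_I_comp)
  interpret D: ring ?D using n_pos by (rule ring_dihedral_algebra)
  from code have C_add: "subgroup C (add_monoid ?D)"
    and C_mult: "\<And>v u. v \<in> carrier ?D \<Longrightarrow> u \<in> C \<Longrightarrow> v \<otimes>\<^bsub>?D\<^esub> u \<in> C"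
    by (auto simp: left_ideal_def additive_subgroup_def)
  have C_sub: "C \<subseteq> carrier ?D" using subgroup.subset[OF C_add] by simp
  have comp_B: "P_comp n r \<alpha> j u \<in> B j" if "u \<in> C" "j \<in> {1..r+s}" for u j
  proof -
    have "P_map n r s \<alpha> u \<in> Pi\<^sub>E {1..r+s} B" using image that(1) by blast
    from PiE_mem[OF this that(2)] that(2) show ?thesis by (simp add: P_map_def)
  qed
  \<comment> \<open>The left ideal of the bound from above.\<close>
  define L where "L = {u \<in> C. \<forall>j\<in>{1..r+s} - K. tau_map n (\<alpha> j) u = 0}"
  have "left_ideal L ?D"
    unfolding left_ideal_def
  proof (intro conjI ballI)
    show "additive_subgroup L ?D"
    proof (intro additive_subgroupI D.add.subgroupI)
      show "L \<subseteq> carrier ?D" using C_sub by (auto simp: L_def)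
      have "\<zero>\<^bsub>?D\<^esub> \<in> L" using subgroup.one_closed[OF C_add] by (simp add: L_def tau_map_zero)
      then show "L \<noteq> {}" by blast
    next
      fix u assume u: "u \<in> L"
      then have uC: "u \<in> carrier ?D" using C_sub by (auto simp: L_def)
      have neg: "tau_map n z (\<ominus>\<^bsub>?D\<^esub> u) + tau_map n z u = 0" for z
        using D.l_neg[OF uC] by (simp flip: tau_map_add add: tau_map_zero)
      have "\<ominus>\<^bsub>?D\<^esub> u \<in> C"
        using subgroup.m_inv_closed[OF C_add, of u] u by (simp add: L_def a_inv_def)
      moreover have "tau_map n z (\<ominus>\<^bsub>?D\<^esub> u) = 0" if "tau_map n z u = 0" for z
        using neg[of z] that by simp
      ultimately show "\<ominus>\<^bsub>?D\<^esub> u \<in> L"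
        using u by (simp add: L_def)
    next
      fix u v assume "u \<in> L" "v \<in> L"
      then show "u \<oplus>\<^bsub>?D\<^esub> v \<in> L"
        using subgroup.m_closed[OF C_add, of u v] by (simp add: L_def tau_map_add)
    qed
  next
    fix v u assume "v \<in> carrier ?D" "u \<in> L"
    then show "v \<otimes>\<^bsub>?D\<^esub> u \<in> L"
      using C_mult alpha_root_of_unity by (simp add: L_def tau_map_mult[OF n_pos])
  qed
  moreover have "C \<inter> cyclic_subalgebra n \<subseteq> L"
  proof
    fix u assume u: "u \<in> C \<inter> cyclic_subalgebra n"
    have "tau_map n (\<alpha> j) u = 0" if j: "j \<in> {1..r+s}" "j \<notin> K" for j
    proof -
      have comp: "P_comp n r \<alpha> j u \<in> B j" using comp_B u j by blast
      consider "j \<in> J\<^sub>2" | "j \<in> J\<^sub>3" | "j \<in> J\<^sub>4" | "j \<notin> J\<^sub>1 \<union> J\<^sub>2 \<union> J\<^sub>3 \<union> J\<^sub>4"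
        using j(2) by (auto simp: K_def)
      then show ?thesis
      proof cases
        case 1
        then have "P_comp n r \<alpha> j u \<in> I_comp n r \<alpha> j 0 1" "\<not> j > r"
          using comp j disj by (auto simp: B_def K_def K)
        then show ?thesis using u j by (intro rotation_component_zero) auto
      next
        case 2
        then have "j \<notin> J\<^sub>1" "j \<notin> J\<^sub>2" using disj by blast+
        with 2 have "P_comp n r \<alpha> j u \<in> I_comp n r \<alpha> j 1 0" "\<not> j > r"
          using comp j by (auto simp: B_def K_def K)
        then show ?thesis using u j by (intro rotation_component_zero) auto
      next
        case 3
        then have "j \<notin> J\<^sub>1" "j \<notin> J\<^sub>2" "j \<notin> J\<^sub>3" using disj by blast+
        with 3 have "P_comp n r \<alpha> j u \<in> I_comp n r \<alpha> j (- x j) 1" "\<not> j \<le> zeta n"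
          using comp J4 by (auto simp: B_def)
        then show ?thesis
          using u j x[OF 3] by (intro rotation_component_zero[where x = "- x j" and y = 1]) auto
      next
        case 4
        then have "P_comp n r \<alpha> j u \<in> zero_comp n j" using comp by (simp add: B_def)
        then show ?thesis using P_comp_in_zero_comp_iff[OF j(1)] by simp
      qed
    qed
    with u show "u \<in> L" by (auto simp: L_def)
  qed
  ultimately have int_L: "interior_code n C \<subseteq> L"
    unfolding interior_code_def by (rule left_ideal_generated_minimal)
  \<comment> \<open>The factors at which the rotation polynomial \<open>e\<close> takes the value 1.\<close>
  define T where "T = J\<^sub>1 \<times> UNIV \<union> K\<^sub>2 \<times> {False} \<union> K\<^sub>3 \<times> {True}"
  obtain p where p: "Polynomial.degree p < n"
    "\<And>t z. t \<in> factor_index \<Longrightarrow> eval_ac (factor t) z = 0 \<Longrightarrow> eval_ac p z = (if t \<in> T then 1 else 0)"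
    by (rule factor_indicator_poly[of T]) blast
  define e where "e = of_rotation_poly n p"
  have tau_e: "tau_map n (\<alpha> j) e =
      (if j \<in> J\<^sub>1 then mat 1 else if j \<in> K\<^sub>2 then mat2 1 0 0 0 else if j \<in> K\<^sub>3 then mat2 0 0 0 1 else 0)"
    if j: "j \<in> {1..r+s}" for j
  proof -
    have at: "eval_ac p (\<alpha> j) = (if (j, False) \<in> T then 1 else 0)"
      using root j by (intro p(2)) (auto simp: factor_index_def factor_def)
    have "eval_ac p (inverse (\<alpha> j)) = (if (j, j > r) \<in> T then 1 else 0)"
      using alpha_inverse_root[of j] alpha_inverse_root_reciprocal[of j] j
      by (intro p(2)) (auto simp: factor_index_def factor_def)
    moreover have "(j, False) \<in> T \<longleftrightarrow> j \<in> J\<^sub>1 \<or> j \<in> K\<^sub>2" by (auto simp: T_def)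
    moreover have "(j, j > r) \<in> T \<longleftrightarrow> j \<in> J\<^sub>1 \<or> j \<in> K\<^sub>3" by (auto simp: T_def K)
    moreover have "\<not> (j \<in> K\<^sub>2 \<and> j \<in> K\<^sub>3)" using disj by (auto simp: K)
    ultimately show ?thesis
      using at by (simp add: e_def tau_map_of_rotation_poly[OF p(1)] mat_1_eq_mat2)
  qed
  have e_cyc: "e \<in> cyclic_subalgebra n"
    unfolding e_def by (rule of_rotation_poly_in_cyclic_subalgebra[OF n_pos])
  have e_car: "e \<in> carrier ?D" using e_cyc by (simp add: cyclic_subalgebra_def)
  have e_comp: "P_comp n r \<alpha> j e \<in> B j" if j: "j \<in> {1..r+s}" for j
  proof -
    consider "j \<in> J\<^sub>1" | "j \<in> K\<^sub>2" | "j \<in> K\<^sub>3" | "j \<notin> K" by (auto simp: K_def)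
    then show ?thesis
    proof cases
      case 1
      then show ?thesis using rotation_component_in_A_comp[OF j, of e] tau_e[OF j] by (simp add: B_def)
    next
      case 2
      then have notin: "j \<notin> J\<^sub>1" "j \<in> J\<^sub>2" "\<not> j \<le> r" using disj by (auto simp: K)
      \<comment> \<open>The matrix of \<open>I_comp n r \<alpha> j 0 1\<close> with \<open>k = 1\<close> and \<open>t = 0\<close>.\<close>
      then have "P_comp n r \<alpha> j e = Inr (mat2 (1 * 1) (- (1 * 0)) (0 * 1) (- (0 * 0)))"
        using tau_e[OF j] 2 r by (simp add: P_comp_def)
      moreover have "\<dots> \<in> I_comp n r \<alpha> j 0 1"
        using notin r F_field_0_1[of j] unfolding I_comp_def by force
      ultimately show ?thesis using notin by (simp add: B_def)
    next
      case 3
      then have notin: "j \<notin> J\<^sub>1" "j \<notin> J\<^sub>2" "j \<in> J\<^sub>3" "\<not> j \<le> r" using disj by (auto simp: K)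
      \<comment> \<open>The matrix of \<open>I_comp n r \<alpha> j 1 0\<close> with \<open>k = 0\<close> and \<open>t = - 1\<close>.\<close>
      then have "P_comp n r \<alpha> j e = Inr (mat2 (0 * 0) (- (0 * 1)) (- 1 * 0) (- (- 1 * 1)))"
        using tau_e[OF j] 3 r by (simp add: P_comp_def K)
      moreover have "\<dots> \<in> I_comp n r \<alpha> j 1 0"
        using notin r F_field_0_1[of j] unfolding I_comp_def by force
      ultimately show ?thesis using notin by (simp add: B_def)
    next
      case 4
      then have "tau_map n (\<alpha> j) e = 0" using tau_e[OF j] by (simp add: K_def)
      then show ?thesis using P_comp_in_zero_comp_iff[OF j, of e] zero_B by blast
    qed
  qed
  \<comment> \<open>All components of \<open>e\<close> are components of elements of \<open>C\<close>; as \<open>P\<close> is injective, \<open>e\<close> itself is in \<open>C\<close>.\<close>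
  have e_C: "e \<in> C"
  proof -
    have "P_map n r s \<alpha> e \<in> Pi\<^sub>E {1..r+s} B" using e_comp by (simp add: P_map_def)
    then obtain c where c: "c \<in> C" "P_map n r s \<alpha> c = P_map n r s \<alpha> e"
      using image by (metis imageE)
    have "tau_map n (\<alpha> j) c = tau_map n (\<alpha> j) e" if "j \<in> {1..r+s}" for j
      using fun_cong[OF c(2), of j] that P_comp_eq_iff[OF that] by (simp add: P_map_def)
    then have "c = e" using c(1) C_sub e_car by (intro tau_map_jointly_injective) auto
    with c(1) show ?thesis by simp
  qed
  show ?thesis
  proof (intro equalityI subsetI)
    fix w assume "w \<in> P_map n r s \<alpha> ` interior_code n C"
    then obtain u where u: "u \<in> L" "w = P_map n r s \<alpha> u" using int_L by blast
    show "w \<in> Pi\<^sub>E {1..r+s} ?B'"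
    proof (rule PiE_I)
      fix j assume j: "j \<in> {1..r+s}"
      have "P_comp n r \<alpha> j u \<in> (if j \<in> K then B j else zero_comp n j)"
        using u(1) j comp_B[of u j] P_comp_in_zero_comp_iff[OF j, of u] by (simp add: L_def)
      then show "w j \<in> ?B' j" unfolding B' using j u(2) by (simp add: P_map_def)
    qed (auto simp: u(2) P_map_def)
  next
    fix w assume w: "w \<in> Pi\<^sub>E {1..r+s} ?B'"
    have "?B' j \<subseteq> B j" for j unfolding B' using zero_B by simp
    then have "Pi\<^sub>E {1..r+s} ?B' \<subseteq> Pi\<^sub>E {1..r+s} B" by (rule PiE_mono)
    with w have "w \<in> Pi\<^sub>E {1..r+s} B" by (rule rev_subsetD)
    then obtain u where u: "u \<in> C" "w = P_map n r s \<alpha> u" using image by (metis imageE)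
    have "P_comp n r \<alpha> j (u \<otimes>\<^bsub>?D\<^esub> e) = P_comp n r \<alpha> j u" if j: "j \<in> {1..r+s}" for j
    proof -
      have comp: "P_comp n r \<alpha> j u \<in> ?B' j"
        using PiE_mem[OF w j] u(2) j by (simp add: P_map_def)
      have mult: "tau_map n (\<alpha> j) (u \<otimes>\<^bsub>?D\<^esub> e) = tau_map n (\<alpha> j) u ** tau_map n (\<alpha> j) e"
        by (rule tau_map_mult[OF n_pos alpha_root_of_unity[OF j]])
      consider "j \<in> J\<^sub>1" | "j \<in> K\<^sub>2" "j \<notin> J\<^sub>1" | "j \<in> K\<^sub>3" "j \<notin> J\<^sub>1" "j \<notin> K\<^sub>2" | "j \<notin> K"
        by (auto simp: K_def)
      then have "tau_map n (\<alpha> j) (u \<otimes>\<^bsub>?D\<^esub> e) = tau_map n (\<alpha> j) u"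
      proof cases
        case 1
        then show ?thesis using tau_e[OF j] by (simp add: mult)
      next
        case 2
        then have "\<not> j \<le> r" by (simp add: K)
        with comp 2 r have "Inr (tau_map n (\<alpha> j) u) \<in> I_comp n r \<alpha> j 0 1" by (simp add: P_comp_def)
        with 2 r \<open>\<not> j \<le> r\<close> show ?thesis using tau_e[OF j] by (auto simp: mult I_comp_def mat2_mult)
      next
        case 3
        then have "\<not> j \<le> r" by (simp add: K)
        with comp 3 r have "Inr (tau_map n (\<alpha> j) u) \<in> I_comp n r \<alpha> j 1 0" by (simp add: P_comp_def)
        with 3 r \<open>\<not> j \<le> r\<close> show ?thesis using tau_e[OF j] by (auto simp: mult I_comp_def mat2_mult)
      next
        case 4
        then have "tau_map n (\<alpha> j) u = 0"
          using comp P_comp_in_zero_comp_iff[OF j, of u] unfolding B' by simp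
        then show ?thesis by (simp add: mult)
      qed
      then show ?thesis using P_comp_eq_iff[OF j] by blast
    qed
    then have "w = P_map n r s \<alpha> (u \<otimes>\<^bsub>?D\<^esub> e)"
      unfolding u(2) P_map_def by (intro restrict_ext) simp
    moreover have "u \<otimes>\<^bsub>?D\<^esub> e \<in> interior_code n C"
      unfolding interior_code_def using u(1) C_sub e_C e_cyc
      by (intro mult_in_left_ideal_generated) auto
    ultimately show "w \<in> P_map n r s \<alpha> ` interior_code n C" by blast
  qed
qed

end

theorem theorem8:
  fixes n r s :: nat
    and f :: "nat \<Rightarrow> ('a::{field,finite}) poly"
    and \<alpha> :: "nat \<Rightarrow> 'a alg_closure"
    and C :: "(bool \<times> int \<Rightarrow> 'a) set"
    and J\<^sub>1 J\<^sub>2 J\<^sub>3 J\<^sub>4 :: "nat set"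
    and x :: "nat \<Rightarrow> 'a alg_closure"
  assumes n: "n \<ge> 2" and coprime: "gcd CARD('a) n = 1"
    and r: "zeta n \<le> r"
    and f1: "f 1 = [:- 1, 1:]"
    and f2: "even n \<longrightarrow> f 2 = [:1, 1:]"
    and irred: "\<forall>j\<in>{1..r+s}. Factorial_Ring.irreducible (f j) \<and> Polynomial.lead_coeff (f j) = 1"
    and factorization: "Polynomial.monom 1 n - 1 =
      (\<Prod>j=1..r. f j) * (\<Prod>j=r+1..r+s. f j * monic_reciprocal (f j))"
    and distinct_factors:
      "distinct (map f [1..<r+s+1] @ map (\<lambda>j. monic_reciprocal (f j)) [r+1..<r+s+1])"
    and self_reciprocal: "\<forall>j. 1 < j \<and> j \<le> r \<longrightarrow> reflect_poly (f j) = f j"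
    and different_roots: "\<forall>j\<in>{r+1..r+s}.
      {z. eval_ac (f j) z = 0} \<inter> {z. eval_ac (reflect_poly (f j)) z = 0} = {}"
    and root: "\<forall>j\<in>{1..r+s}. eval_ac (f j) (\<alpha> j) = 0"
    and code: "left_ideal C (dihedral_algebra n)"
    and J: "J\<^sub>1 \<subseteq> {1..r+s}" "J\<^sub>2 \<subseteq> {1..r+s}" "J\<^sub>3 \<subseteq> {1..r+s}" "J\<^sub>4 \<subseteq> {zeta n + 1..r+s}"
    and J_disjoint: "J\<^sub>1 \<inter> J\<^sub>2 = {}" "J\<^sub>1 \<inter> J\<^sub>3 = {}" "J\<^sub>1 \<inter> J\<^sub>4 = {}"
      "J\<^sub>2 \<inter> J\<^sub>3 = {}" "J\<^sub>2 \<inter> J\<^sub>4 = {}" "J\<^sub>3 \<inter> J\<^sub>4 = {}"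
    and J2: "even CARD('a) \<longrightarrow> 1 \<notin> J\<^sub>2"
    and x: "\<forall>j\<in>J\<^sub>4. x j \<in> F_field n r \<alpha> j \<and> x j \<noteq> 0"
    and image: "P_map n r s \<alpha> ` C =
      (\<Pi>\<^sub>E j\<in>{1..r+s}.
        if j \<in> J\<^sub>1 then A_comp n r \<alpha> j
        else if j \<in> J\<^sub>2 then I_comp n r \<alpha> j 0 1
        else if j \<in> J\<^sub>3 then I_comp n r \<alpha> j 1 0
        else if j \<in> J\<^sub>4 then I_comp n r \<alpha> j (- x j) 1
        else zero_comp n j)"
  shows "let K\<^sub>1 = J\<^sub>1; K\<^sub>2 = {j \<in> J\<^sub>2. r + 1 \<le> j \<and> j \<le> r + s};
             K\<^sub>3 = {j \<in> J\<^sub>3. r + 1 \<le> j \<and> j \<le> r + s}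
         in P_map n r s \<alpha> ` interior_code n C =
           (\<Pi>\<^sub>E j\<in>{1..r+s}.
             if j \<in> K\<^sub>1 then A_comp n r \<alpha> j
             else if j \<in> K\<^sub>2 then I_comp n r \<alpha> j 0 1
             else if j \<in> K\<^sub>3 then I_comp n r \<alpha> j 1 0
             else zero_comp n j)"
proof -
  interpret dihedral_factorization n r s f \<alpha>
    using n coprime r f1 f2 irred factorization self_reciprocal root by unfold_locales blast+
  show ?thesis
    unfolding Let_def using x
    by (intro P_map_interior_code[OF code J(4) J_disjoint _ image refl refl]) blast
qed

end
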